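(* Let $X$ and $Y$ be Banach lattices such that $X$ is order continuous and has the subsequence splitting property. Let $S,T\colon X\to Y$ be linear operators with $0\le S\le T$. If $T$ is weakly Banach-Saks, then $S$ is weakly Banach-Saks.
   Context: A Banach lattice is order continuous if $x_\alpha\downarrow 0$ implies $\|x_\alpha\|\to 0$ for every net. A subset $A$ of a Banach lattice $X$, with $B_X$ the closed unit ball, is almost order bounded if for every $\varepsilon>0$ there is $u\in X_+$ with $A\subseteq[-u,u]+\varepsilon B_X$; a sequence is almost order bounded if its set of terms is. An order continuous Banach lattice $X$ has the subsequence splitting property if for every norm bounded sequence $(x_n)$ in $X$ there exist a subsequence $(x_{n_k})$ and sequences $(y_k)$, $(z_k)$ in $X$ such that $x_{n_k}=y_k+z_k$, $(y_k)$ is almost order bounded, $(z_k)$ is pairwise disjoint, and $y_k\perp z_k$ (i.e. $|y_k|\wedge|z_k|=0$) for all $k$. $0\le S\le T$ means $0\le Sx\le Tx$ for all $x\in X_+$. An operator $T\colon X\to Y$ is weakly Banach-Saks if for every weakly null sequence $(x_n)$ in $X$, $(Tx_n)$ has a subsequence $(w_n)$ whose Cesàro means $\frac1n\sum_{k=1}^n w_k$ converge in norm. *)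

theory Defs
  imports "HOL-Analysis.Analysis" "HOL-Library.Lattice_Algebras"
begin

(* Here abs x = sup x (- x) (from lattice_ab_group_add_abs). *)
class banach_lattice = banach + ordered_real_vector + lattice_ab_group_add_abs +
  assumes norm_mono_abs: "\<bar>x\<bar> \<le> \<bar>y\<bar> \<Longrightarrow> norm x \<le> norm y"

instance real :: banach_lattice
  by standard simp

definition directed_preorder :: "'i set \<Rightarrow> ('i \<Rightarrow> 'i \<Rightarrow> bool) \<Rightarrow> bool" where
  "directed_preorder I le \<longleftrightarrow>
     I \<noteq> {} \<and>
     (\<forall>i\<in>I. le i i) \<and>
     (\<forall>i\<in>I. \<forall>j\<in>I. \<forall>k\<in>I. le i j \<longrightarrow> le j k \<longrightarrow> le i k) \<and>
     (\<forall>i\<in>I. \<forall>j\<in>I. \<exists>k\<in>I. le i k \<and> le j k)"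

definition net_decreasing_to_zero ::
    "'i set \<Rightarrow> ('i \<Rightarrow> 'i \<Rightarrow> bool) \<Rightarrow> ('i \<Rightarrow> 'a::banach_lattice) \<Rightarrow> bool" where
  "net_decreasing_to_zero I le x \<longleftrightarrow>
     (\<forall>i\<in>I. \<forall>j\<in>I. le i j \<longrightarrow> x j \<le> x i) \<and>
     (\<forall>i\<in>I. 0 \<le> x i) \<and> (\<forall>z. (\<forall>i\<in>I. z \<le> x i) \<longrightarrow> z \<le> 0)"

definition net_norm_null ::
    "'i set \<Rightarrow> ('i \<Rightarrow> 'i \<Rightarrow> bool) \<Rightarrow> ('i \<Rightarrow> 'a::real_normed_vector) \<Rightarrow> bool" where
  "net_norm_null I le x \<longleftrightarrow>
     (\<forall>\<epsilon>>0. \<exists>i\<in>I. \<forall>j\<in>I. le i j \<longrightarrow> norm (x j) < \<epsilon>)"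

(* A definition cannot quantify over all index types, so the index sets range over the
   subsets of the space itself; by order_continuous_net below this covers every net. *)
definition order_continuous :: "'a::banach_lattice itself \<Rightarrow> bool" where
  "order_continuous _ \<longleftrightarrow>
     (\<forall>(I :: 'a set) le (x :: 'a \<Rightarrow> 'a).
        directed_preorder I le \<longrightarrow> net_decreasing_to_zero I le x \<longrightarrow> net_norm_null I le x)"

lemma order_continuous_net:
  fixes I :: "'i set" and x :: "'i \<Rightarrow> 'a::banach_lattice"
  assumes oc: "order_continuous TYPE('a)"
    and dir: "directed_preorder I le" and dec: "net_decreasing_to_zero I le x"
  shows "net_norm_null I le x"
proof -
  let ?ge = "\<lambda>a b :: 'a. b \<le> a"
  have ne: "I \<noteq> {}" and ub: "\<And>i j. i \<in> I \<Longrightarrow> j \<in> I \<Longrightarrow> \<exists>k\<in>I. le i k \<and> le j k"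
    using dir unfolding directed_preorder_def by blast+
  have mono: "\<And>i j. i \<in> I \<Longrightarrow> j \<in> I \<Longrightarrow> le i j \<Longrightarrow> x j \<le> x i"
    using dec unfolding net_decreasing_to_zero_def by blast
  have lower: "\<exists>c\<in>x ` I. c \<le> a \<and> c \<le> b" if ab: "a \<in> x ` I" "b \<in> x ` I" for a b
  proof -
    obtain i j where ij: "i \<in> I" "j \<in> I" "a = x i" "b = x j" using ab by blast
    then obtain k where "k \<in> I" "le i k" "le j k" using ub by blast
    then show ?thesis using ij mono by blast
  qed
  have "directed_preorder (x ` I) ?ge"
    unfolding directed_preorder_def
  proof (intro conjI ballI impI)
    show "x ` I \<noteq> {}" using ne by simp
    show "a \<le> a" for a :: 'a by simp
    show "c \<le> a" if "b \<le> a" "c \<le> b" for a b c :: 'a using that by (rule order_trans[rotated])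
    show "\<exists>c\<in>x ` I. c \<le> a \<and> c \<le> b" if "a \<in> x ` I" "b \<in> x ` I" for a b
      using that by (rule lower)
  qed
  moreover have "net_decreasing_to_zero (x ` I) ?ge (\<lambda>a. a)"
    using dec by (auto simp: net_decreasing_to_zero_def)
  ultimately have null: "net_norm_null (x ` I) ?ge (\<lambda>a. a)"
    using oc unfolding order_continuous_def by blast
  show ?thesis
    unfolding net_norm_null_def
  proof (intro allI impI)
    fix \<epsilon> :: real assume "\<epsilon> > 0"
    then obtain i where "i \<in> I" "\<forall>b\<in>x ` I. b \<le> x i \<longrightarrow> norm b < \<epsilon>"
      using null unfolding net_norm_null_def by blast
    then show "\<exists>i\<in>I. \<forall>j\<in>I. le i j \<longrightarrow> norm (x j) < \<epsilon>"
      using mono by blast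
  qed
qed

definition almost_order_bounded :: "'a::banach_lattice set \<Rightarrow> bool" where
  "almost_order_bounded A \<longleftrightarrow>
     (\<forall>\<epsilon>>0. \<exists>u\<ge>0. A \<subseteq> {v + \<epsilon> *\<^sub>R b | v b. v \<in> {-u..u} \<and> b \<in> cball 0 1})"

definition disjoint_elements :: "'a::banach_lattice \<Rightarrow> 'a \<Rightarrow> bool" where
  "disjoint_elements x y \<longleftrightarrow> inf \<bar>x\<bar> \<bar>y\<bar> = 0"

definition subsequence_splitting :: "'a::banach_lattice itself \<Rightarrow> bool" where
  "subsequence_splitting _ \<longleftrightarrow>
     (\<forall>x :: nat \<Rightarrow> 'a. bounded (range x) \<longrightarrow>
        (\<exists>(r :: nat \<Rightarrow> nat) y z. strict_mono r \<and>
           (\<forall>k. x (r k) = y k + z k) \<and>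
           almost_order_bounded (range y) \<and>
           (\<forall>j k. j \<noteq> k \<longrightarrow> disjoint_elements (z j) (z k)) \<and>
           (\<forall>k. disjoint_elements (y k) (z k))))"

definition weakly_null :: "(nat \<Rightarrow> 'a::real_normed_vector) \<Rightarrow> bool" where
  "weakly_null x \<longleftrightarrow>
     (\<forall>f :: 'a \<Rightarrow> real. bounded_linear f \<longrightarrow> (\<lambda>n. f (x n)) \<longlonglongrightarrow> 0)"

definition cesaro_mean :: "(nat \<Rightarrow> 'a::real_vector) \<Rightarrow> nat \<Rightarrow> 'a" where
  "cesaro_mean w n = (1 / real (Suc n)) *\<^sub>R (\<Sum>k\<le>n. w k)"

definition weakly_Banach_Saks ::
    "('a::real_normed_vector \<Rightarrow> 'b::real_normed_vector) \<Rightarrow> bool" where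
  "weakly_Banach_Saks T \<longleftrightarrow>
     (\<forall>x. weakly_null x \<longrightarrow>
        (\<exists>r :: nat \<Rightarrow> nat. strict_mono r \<and> convergent (cesaro_mean (\<lambda>n. T (x (r n))))))"

end

theory Submission
  imports Defs "HOL-Complex_Analysis.Great_Picard"
begin

text \<open>
  Split a weakly null sequence as \<open>y + z\<close> with \<open>y\<close> almost order bounded and \<open>z\<close> disjoint. The two
  parts behave independently of each other.

  In an order continuous lattice, every almost order bounded sequence has a subsequence all of whose
  further subsequences have norm convergent Cesaro means with a common limit \<open>w\<close>. Up to an
  \<open>\<epsilon>\<close>-perturbation the sequence lies in \<open>[-u, u]\<close>. There the norm is controlled by a single positive
  functional \<open>f\<close> (a lattice version of the Bartle--Dunford--Schwartz control measure), hence by the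
  quadratic form \<open>x \<mapsto> f (x\<^sup>2)\<close>, where the square relative to \<open>u\<close> is \<open>sup\<^sub>t (2tx - t\<^sup>2u)\<close>; the
  parallelogram law follows directly from this formula. Along a subsequence the Gram matrix has an
  off-diagonal limit, which gives the Banach--Saks property for the quadratic form.

  For the disjoint part, \<open>\<bar>z\<bar>\<close> is again weakly null, so \<open>T \<bar>z\<bar>\<close> has a subsequence with norm null
  Cesaro means; these dominate the Cesaro means of \<open>S z\<close>. Those of \<open>S y\<close> converge to \<open>S w\<close> since the
  positive operator \<open>S\<close> is bounded.
\<close>

subsection \<open>The Hahn--Banach theorem\<close>

definition sublinear :: "('a::real_vector \<Rightarrow> real) \<Rightarrow> bool" where
  "sublinear p \<longleftrightarrow> (\<forall>x y. p (x + y) \<le> p x + p y) \<and> (\<forall>t x. 0 \<le> t \<longrightarrow> p (t *\<^sub>R x) = t * p x)"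

lemma sublinear_add: "sublinear p \<Longrightarrow> p (x + y) \<le> p x + p y"
  by (simp add: sublinear_def)

lemma sublinear_scale: "sublinear p \<Longrightarrow> 0 \<le> t \<Longrightarrow> p (t *\<^sub>R x) = t * p x"
  by (simp add: sublinear_def)

lemma sublinear_0: "sublinear p \<Longrightarrow> p 0 = 0"
  using sublinear_scale[of p 0 0] by simp

lemma sublinear_neg: "sublinear p \<Longrightarrow> - p (- x) \<le> p x"
  using sublinear_add[of p x "- x"] sublinear_0[of p] by simp

text \<open>The reverse inequality for homogeneity is the assumed one for \<open>inverse t\<close>
  at \<open>t *\<^sub>R x\<close>.\<close>

lemma sublinearI:
  assumes add: "\<And>x y. p (x + y) \<le> p x + p y"
    and scale: "\<And>t x. 0 < t \<Longrightarrow> p (t *\<^sub>R x) \<le> t * p x" and zero: "p 0 = 0"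
  shows "sublinear p"
  unfolding sublinear_def
proof (intro conjI allI impI add)
  fix t :: real and x assume "0 \<le> t"
  show "p (t *\<^sub>R x) = t * p x"
  proof (cases "t = 0")
    case False
    with \<open>0 \<le> t\<close> have t: "0 < t" by simp
    have "p x \<le> inverse t * p (t *\<^sub>R x)"
      using scale[of "inverse t" "t *\<^sub>R x"] t by simp
    then have "t * p x \<le> p (t *\<^sub>R x)"
      using t by (simp add: field_simps)
    then show ?thesis using scale[OF t, of x] by simp
  qed (simp add: zero)
qed

text \<open>A pair \<open>(v, c)\<close> in \<open>K\<close> encodes the constraint
  \<open>q v <= c\<close>. The infimal convolution of \<open>p\<close> with \<open>K\<close> is the
  largest sublinear functional below \<open>p\<close> meeting all constraints, and
  \<open>Kbound\<close> keeps the infimum finite. Applied to a ray it shows that minimal sublinear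
  functionals are linear; applied to a graph it gives the extension theorem.\<close>

lemma sublinear_cone_reduction:
  fixes p :: "'a::real_vector \<Rightarrow> real" and K :: "('a \<times> real) set"
  assumes p: "sublinear p" and K0: "0 \<in> K"
    and Kadd: "\<And>k l. k \<in> K \<Longrightarrow> l \<in> K \<Longrightarrow> k + l \<in> K"
    and Kscale: "\<And>t k. 0 < t \<Longrightarrow> k \<in> K \<Longrightarrow> t *\<^sub>R k \<in> K"
    and Kbound: "\<And>v c. (v, c) \<in> K \<Longrightarrow> - c \<le> p (- v)"
  shows "\<exists>q. sublinear q \<and> (\<forall>x. q x \<le> p x) \<and> (\<forall>v c. (v, c) \<in> K \<longrightarrow> q v \<le> c)"
proof -
  define q where "q x = (INF k\<in>K. p (x - fst k) + snd k)" for x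
  have ge: "- p (- x) \<le> p (x - fst k) + snd k" if "k \<in> K" for x k
    using Kbound[of "fst k" "snd k"] sublinear_add[OF p, of "x - fst k" "- x"] that by simp
  then have bdd: "bdd_below ((\<lambda>k. p (x - fst k) + snd k) ` K)" for x
    by (intro bdd_belowI2)
  have le: "q x \<le> p (x - fst k) + snd k" if "k \<in> K" for x k
    unfolding q_def by (rule cINF_lower[OF bdd that])
  have Kne: "K \<noteq> {}" using K0 by blast
  have gr: "b \<le> q x" if "\<And>k. k \<in> K \<Longrightarrow> b \<le> p (x - fst k) + snd k" for b x
    unfolding q_def by (rule cINF_greatest[OF Kne that])
  have qp: "q x \<le> p x" for x using le[OF K0, of x] by simp
  show ?thesis
  proof (intro exI[of _ q] conjI sublinearI allI impI)
    fix x y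
    \<comment> \<open>The sum \<open>k + l\<close> competes in the infimum for \<open>x + y\<close>;
      the infima over \<open>l\<close> and then over \<open>k\<close> are taken one at a
      time.\<close>
    have 1: "q (x + y) \<le> (p (x - fst k) + snd k) + (p (y - fst l) + snd l)"
      if "k \<in> K" "l \<in> K" for k l
      using le[OF Kadd[OF that], of "x + y"] sublinear_add[OF p, of "x - fst k" "y - fst l"]
      by (simp add: algebra_simps)
    have "q (x + y) - (p (x - fst k) + snd k) \<le> q y" if "k \<in> K" for k
      by (rule gr) (use 1[OF that] in fastforce)
    then have "q (x + y) - q y \<le> q x" by (intro gr) fastforce
    then show "q (x + y) \<le> q x + q y" by simp
  next
    fix t :: real and x assume t: "0 < t"
    have "q (t *\<^sub>R x) / t \<le> q x"
    proof (rule gr)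
      fix k assume "k \<in> K"
      from le[OF Kscale[OF t this], of "t *\<^sub>R x"]
      have "q (t *\<^sub>R x) \<le> t * (p (x - fst k) + snd k)"
        using sublinear_scale[OF p, of t "x - fst k"] t by (simp add: algebra_simps)
      then show "q (t *\<^sub>R x) / t \<le> p (x - fst k) + snd k" using t by (simp add: field_simps)
    qed
    then show "q (t *\<^sub>R x) \<le> t * q x" using t by (simp add: field_simps)
  next
    show "q 0 = 0" using qp[of 0] gr[of 0 0] ge[of _ 0] sublinear_0[OF p] by force
  next
    show "q x \<le> p x" for x by (rule qp)
  next
    show "q v \<le> c" if "(v, c) \<in> K" for v c
      using le[OF that, of v] sublinear_0[OF p] by simp
  qed
qed

text \<open>Imposing the constraint \<open>r (- x) <= - q x\<close> produces a sublinear functional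
  below \<open>q\<close>, which by minimality is \<open>q\<close> itself. So \<open>q\<close> is
  odd, and an odd sublinear functional is linear.\<close>

lemma sublinear_minimal_linear:
  assumes q: "sublinear q" and min: "\<And>r. sublinear r \<Longrightarrow> (\<And>x. r x \<le> q x) \<Longrightarrow> r = q"
  shows "linear q"
proof -
  have neg: "q (- x) = - q x" for x
  proof -
    define K where "K = {(- t *\<^sub>R x, - t * q x) |t. 0 \<le> t}"
    have "- c \<le> q (- v)" if "(v, c) \<in> K" for v c
      using that sublinear_scale[OF q, of _ x] by (auto simp: K_def)
    moreover have "k + l \<in> K" if "k \<in> K" "l \<in> K" for k l
    proof -
      obtain t s where "0 \<le> t" "0 \<le> s" "k = (- t *\<^sub>R x, - t * q x)" "l = (- s *\<^sub>R x, - s * q x)"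
        using \<open>k \<in> K\<close> \<open>l \<in> K\<close> unfolding K_def by blast
      then show ?thesis unfolding K_def by (intro CollectI exI[of _ "t + s"]) (simp add: algebra_simps)
    qed
    moreover have "a *\<^sub>R k \<in> K" if "0 < a" "k \<in> K" for a k
    proof -
      obtain t where "0 \<le> t" "k = (- t *\<^sub>R x, - t * q x)" using \<open>k \<in> K\<close> unfolding K_def by blast
      then show ?thesis using \<open>0 < a\<close> unfolding K_def by (intro CollectI exI[of _ "a * t"]) simp
    qed
    moreover have "0 \<in> K" by (auto simp: K_def zero_prod_def)
    ultimately obtain r where r: "sublinear r" "\<And>x. r x \<le> q x" "\<And>v c. (v, c) \<in> K \<Longrightarrow> r v \<le> c"
      using sublinear_cone_reduction[OF q, of K] by blast
    have "(- x, - q x) \<in> K" unfolding K_def by (intro CollectI exI[of _ 1]) simp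
    then have "q (- x) \<le> - q x" using r(3) min[OF r(1,2)] by auto
    then show ?thesis using sublinear_neg[OF q, of x] by simp
  qed
  show ?thesis
  proof
    fix x y
    show "q (x + y) = q x + q y"
      using sublinear_add[OF q, of x y] sublinear_add[OF q, of "x + y" "- y"] neg[of y] by simp
  next
    fix t x show "q (t *\<^sub>R x) = t *\<^sub>R q x"
      using sublinear_scale[OF q, of t x] sublinear_scale[OF q, of "- t" x] neg[of "t *\<^sub>R x"]
      by (cases "0 \<le> t") auto
  qed
qed

text \<open>Zorn's lemma for the reversed pointwise order on the sublinear functionals below
  \<open>p\<close>: pointwise infima bound chains, and a minimal element is linear.\<close>

lemma sublinear_dominates_linear:
  assumes p: "sublinear p"
  obtains f where "linear f" "\<And>x. f x \<le> p x"
proof -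
  define A where "A = {q. sublinear q \<and> (\<forall>x. q x \<le> p x)}"
  let ?P = "\<lambda>q r. \<forall>x. r x \<le> (q x :: real)"
  have po: "partial_order_on A (relation_of ?P A)"
    by (rule partial_order_on_relation_ofI) (auto intro: order_trans intro!: ext antisym)
  have "\<exists>u\<in>A. \<forall>q\<in>C. ?P q u" if C: "C \<in> Chains (relation_of ?P A)" for C
  proof (cases "C = {}")
    case True
    then show ?thesis using p by (auto simp: A_def)
  next
    case False
    have CA: "sublinear q" "q x \<le> p x" if "q \<in> C" for q x
      using C that by (auto simp: Chains_def relation_of_def A_def)
    have chain: "(\<forall>x. q x \<le> r x) \<or> (\<forall>x. r x \<le> q x)" if "q \<in> C" "r \<in> C" for q r
      using C that by (auto simp: Chains_def relation_of_def)
    define u where "u x = (INF q\<in>C. q x)" for x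
    have "- p (- x) \<le> q x" if "q \<in> C" for q x
      using sublinear_neg[OF CA(1)[OF that], of x] CA(2)[OF that, of "- x"] by simp
    then have bdd: "bdd_below ((\<lambda>q. q x) ` C)" for x by (intro bdd_belowI2)
    have le: "u x \<le> q x" if "q \<in> C" for q x
      unfolding u_def by (rule cINF_lower[OF bdd that])
    have gr: "b \<le> u x" if "\<And>q. q \<in> C \<Longrightarrow> b \<le> q x" for b x
      unfolding u_def by (rule cINF_greatest[OF False that])
    have "sublinear u"
    proof (rule sublinearI)
      fix x y
      \<comment> \<open>Of two members of a chain the smaller one can be used at both
        arguments.\<close>
      have 1: "u (x + y) \<le> q x + r y" if qr: "q \<in> C" "r \<in> C" for q r
        using chain[OF qr] le[OF qr(1), of "x + y"] le[OF qr(2), of "x + y"]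
          sublinear_add[OF CA(1)[OF qr(1)], of x y] sublinear_add[OF CA(1)[OF qr(2)], of x y]
        by (smt (verit))
      have "u (x + y) - q x \<le> u y" if "q \<in> C" for q
        by (rule gr) (use 1[OF that] in fastforce)
      then have "u (x + y) - u y \<le> u x" by (intro gr) fastforce
      then show "u (x + y) \<le> u x + u y" by simp
    next
      fix t :: real and x assume t: "0 < t"
      have "u (t *\<^sub>R x) / t \<le> u x"
      proof (rule gr)
        fix q assume "q \<in> C"
        then show "u (t *\<^sub>R x) / t \<le> q x"
          using le[of q "t *\<^sub>R x"] sublinear_scale[OF CA(1), of q t x] t by (simp add: field_simps)
      qed
      then show "u (t *\<^sub>R x) \<le> t * u x" using t by (simp add: field_simps)
    next
      have "(\<lambda>q. q 0) ` C = {0}" using False sublinear_0[OF CA(1)] by force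
      then show "u 0 = 0" by (simp add: u_def)
    qed
    moreover have "u x \<le> p x" for x using False le CA(2) by (meson all_not_in_conv order_trans)
    ultimately show ?thesis using le by (auto simp: A_def)
  qed
  from predicate_Zorn[OF po this]
  obtain q where q: "q \<in> A" "\<And>r. r \<in> A \<Longrightarrow> \<forall>x. r x \<le> q x \<Longrightarrow> r = q" by blast
  have "linear q"
  proof (rule sublinear_minimal_linear)
    show "sublinear q" using q(1) by (simp add: A_def)
    fix r assume "sublinear r" "\<And>x. r x \<le> q x"
    moreover have "q x \<le> p x" for x using q(1) by (simp add: A_def)
    ultimately have "r \<in> A" unfolding A_def by (blast intro: order_trans)
    then show "r = q" using q(2) \<open>\<And>x. r x \<le> q x\<close> by blast
  qed
  with that q(1) show thesis unfolding A_def by blast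
qed

text \<open>The partial functional is given by its graph, so no domain has to be carried along; the
  bound at \<open>(0, c)\<close> and \<open>(0, - c)\<close> makes it single valued. Since the graph
  is closed under negation, the one-sided constraints \<open>q v <= c\<close> become equalities for
  a linear functional below \<open>q\<close>.\<close>

theorem Hahn_Banach_graph:
  fixes p :: "'a::real_vector \<Rightarrow> real" and G :: "('a \<times> real) set"
  assumes p: "sublinear p" and G: "subspace G" and le: "\<And>v c. (v, c) \<in> G \<Longrightarrow> c \<le> p v"
  shows "\<exists>f. linear f \<and> (\<forall>x. f x \<le> p x) \<and> (\<forall>v c. (v, c) \<in> G \<longrightarrow> f v = c)"
proof -
  have neg: "(- v, - c) \<in> G" if "(v, c) \<in> G" for v c
    using subspace_neg[OF G that] by simp
  then have "- c \<le> p (- v)" if "(v, c) \<in> G" for v c using le that by blast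
  then obtain q where q: "sublinear q" "\<And>x. q x \<le> p x" "\<And>v c. (v, c) \<in> G \<Longrightarrow> q v \<le> c"
    using sublinear_cone_reduction[OF p subspace_0[OF G] subspace_add[OF G] subspace_scale[OF G]]
    by blast
  obtain f where f: "linear f" "\<And>x. f x \<le> q x"
    using sublinear_dominates_linear[OF q(1)] by blast
  have fG: "f v \<le> c" if "(v, c) \<in> G" for v c using f(2)[of v] q(3)[OF that] by simp
  have "f v = c" if "(v, c) \<in> G" for v c
    using fG[OF that] fG[OF neg[OF that]] linear_neg[OF f(1), of v] by simp
  with f q(2) show ?thesis by (meson order_trans)
qed

text \<open>Extends the functional on the line through \<open>a\<close> that takes the value
  \<open>p a\<close> at \<open>a\<close>; at negative multiples the bound is
  \<open>sublinear_neg\<close>.\<close>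

lemma Hahn_Banach_support:
  fixes p :: "'a::real_vector \<Rightarrow> real"
  assumes p: "sublinear p"
  obtains f where "linear f" "\<And>x. f x \<le> p x" "f a = p a"
proof -
  have "c \<le> p v" if "(v, c) \<in> span {(a, p a)}" for v c
  proof -
    obtain t where "v = t *\<^sub>R a" "c = t * p a" using \<open>(v, c) \<in> _\<close> by (auto simp: span_singleton)
    then show ?thesis
      using sublinear_scale[OF p, of t a] sublinear_scale[OF p, of "- t" a] sublinear_neg[OF p, of v]
      by (cases "0 \<le> t") auto
  qed
  then obtain f where "linear f" "\<And>x. f x \<le> p x" "\<And>v c. (v, c) \<in> span {(a, p a)} \<Longrightarrow> f v = c"
    using Hahn_Banach_graph[OF p subspace_span, of "{(a, p a)}"] by blast
  then show thesis using that by (meson insertI1 span_base)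
qed

section \<open>Norming functionals and uniform boundedness\<close>

lemma dominated_linear_bounded:
  fixes f :: "'a::real_normed_vector \<Rightarrow> real"
  assumes "linear f" "\<And>x. f x \<le> C * norm x"
  shows "\<bar>f x\<bar> \<le> C * norm x" "bounded_linear f"
proof -
  show *: "\<bar>f x\<bar> \<le> C * norm x" for x
    using assms(2)[of x] assms(2)[of "- x"] linear_neg[OF assms(1), of x] by simp
  show "bounded_linear f"
    using assms(1) * by (intro linear_conv_bounded_linear bounded_linear_intro[where K=C])
      (auto simp: linear_add linear_scale mult.commute)
qed

lemma sublinear_norm: "0 \<le> C \<Longrightarrow> sublinear (\<lambda>x. C * norm x)"
  by (rule sublinearI) (auto simp flip: distrib_left intro!: mult_left_mono norm_triangle_ineq)

lemma norming_functional:
  fixes a :: "'a::real_normed_vector"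
  obtains f where "bounded_linear f" "\<And>x. \<bar>f x\<bar> \<le> norm x" "f a = norm a"
proof -
  have "sublinear (norm :: 'a \<Rightarrow> real)" using sublinear_norm[of 1] by simp
  then obtain f :: "'a \<Rightarrow> real" where f: "linear f" "\<And>x. f x \<le> norm x" "f a = norm a"
    using Hahn_Banach_support[of norm a] by blast
  show thesis
    using that[of f] dominated_linear_bounded[of f 1] f by simp
qed

text \<open>Uniform boundedness principle in the complete dual space: the closed sets
  \<open>F M\<close> of functionals bounded by \<open>M\<close> on the sequence cover the dual, so
  by Baire one of them contains a ball.\<close>

lemma weakly_null_bounded:
  fixes x :: "nat \<Rightarrow> 'a::real_normed_vector"
  assumes "weakly_null x"
  shows "bounded (range x)"
proof -
  define F where "F M = {\<phi> :: 'a \<Rightarrow>\<^sub>L real. \<forall>n. \<bar>blinfun_apply \<phi> (x n)\<bar> \<le> real M}" for M :: nat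
  have clF: "closed (F M)" for M
    unfolding F_def by (intro closed_Collect_all closed_Collect_le continuous_intros)
  have cov: "(\<Union>M. F M) = UNIV"
  proof -
    have "\<exists>M. \<phi> \<in> F M" for \<phi>
    proof -
      have "(\<lambda>n. blinfun_apply \<phi> (x n)) \<longlonglongrightarrow> 0"
        using assms unfolding weakly_null_def by (simp add: blinfun.bounded_linear_right)
      then obtain K where K: "\<And>n. norm (blinfun_apply \<phi> (x n)) \<le> K"
        by (meson BseqE convergentI convergent_imp_Bseq)
      obtain M where "K \<le> real M" using real_arch_simple by blast
      then show ?thesis using K unfolding F_def by (auto intro: order_trans)
    qed
    then show ?thesis by blast
  qed
  have "\<exists>M. interior (F M) \<noteq> {}"
  proof (rule ccontr)
    assume "\<nexists>M. interior (F M) \<noteq> {}"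
    then have "euclidean interior_of \<Union>(range F) = {}"
      using clF by (intro Baire_category_alt[OF disjI1])
        (auto simp: completely_metrizable_space_euclidean closedin_def)
    then show False using cov by (simp add: )
  qed
  then obtain M \<phi> where "\<phi> \<in> interior (F M)" by blast
  then obtain e where e: "0 < e" "cball \<phi> e \<subseteq> F M" using mem_interior_cball by blast
  have "norm (x n) \<le> 2 * real M / e" for n
  proof -
    obtain f where f: "bounded_linear f" "\<And>y. \<bar>f y\<bar> \<le> norm y" "f (x n) = norm (x n)"
      using norming_functional by blast
    define \<psi> where "\<psi> = Blinfun f"
    have app: "blinfun_apply \<psi> = f" unfolding \<psi>_def by (rule bounded_linear_Blinfun_apply[OF f(1)])
    have "norm \<psi> \<le> 1" by (rule norm_blinfun_bound) (auto simp: app f(2))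
    \<comment> \<open>Moving from the centre of the ball in the direction that norms
      \<open>x n\<close> changes the value at \<open>x n\<close> by \<open>e * norm (x n)\<close>,
      while both values are at most \<open>M\<close> in modulus.\<close>
    then have "\<phi> + e *\<^sub>R \<psi> \<in> F M" "\<phi> \<in> F M" using e by (auto simp: dist_norm mult_left_le)
    then have "\<bar>blinfun_apply \<phi> (x n) + e * norm (x n)\<bar> \<le> M" "\<bar>blinfun_apply \<phi> (x n)\<bar> \<le> M"
      unfolding F_def by (auto simp: blinfun.add_left blinfun.scaleR_left app simp flip: f(3))
    then have "e * norm (x n) \<le> 2 * real M" by linarith
    then show ?thesis using e by (simp add: field_simps)
  qed
  then show ?thesis by (auto simp: bounded_iff)
qed

subsection \<open>Banach lattices and positive operators\<close>

lemma banach_lattice_norm_mono: "0 \<le> x \<Longrightarrow> x \<le> y \<Longrightarrow> norm x \<le> norm (y::'a::banach_lattice)"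
  by (intro norm_mono_abs) (auto intro: order_trans)

lemma norm_abs_lattice [simp]: "norm \<bar>x\<bar> = norm (x::'a::banach_lattice)"
  by (intro antisym norm_mono_abs) auto

lemma norm_pos_part_le: "norm (sup x 0) \<le> norm (x::'a::banach_lattice)"
  using banach_lattice_norm_mono[of "sup x 0" "\<bar>x\<bar>"] by (simp add: abs_ge_self)

text \<open>Both \<open>a\<close> and \<open>c\<close> lie below \<open>sup b c\<close> plus the
  modulus of \<open>a - b\<close>; then exchange \<open>a\<close> and \<open>b\<close>.\<close>

lemma abs_sup_diff_le:
  fixes a b c :: "'a::banach_lattice" shows "\<bar>sup a c - sup b c\<bar> \<le> \<bar>a - b\<bar>"
proof -
  have "sup a c \<le> sup b c + \<bar>a - b\<bar>" for a b
  proof (rule sup_least)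
    show "a \<le> sup b c + \<bar>a - b\<bar>"
      using add_mono[OF sup_ge1[of b c] abs_ge_self[of "a - b"]] by simp
    show "c \<le> sup b c + \<bar>a - b\<bar>"
      using add_mono[OF sup_ge2[of c b] abs_ge_zero[of "a - b"]] by simp
  qed
  from this[of a b] this[of b a] show ?thesis
    by (intro abs_leI) (simp_all add: diff_le_eq add.commute abs_minus_commute del: diff_sup_eq_inf)
qed

text \<open>The positive cone is norm closed because the positive part is a nonexpansive map fixing
  every \<open>x n\<close>, hence also fixing the limit.\<close>

lemma tendsto_nonneg_lattice:
  fixes x :: "nat \<Rightarrow> 'a::banach_lattice"
  assumes "x \<longlonglongrightarrow> l" "\<And>n. 0 \<le> x n" shows "0 \<le> l"
proof -
  have "norm (sup l 0 - l) \<le> 2 * norm (x n - l)" for n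
  proof -
    have "norm (sup l 0 - sup (x n) 0) \<le> norm (l - x n)"
      by (intro norm_mono_abs abs_sup_diff_le)
    moreover have "sup (x n) 0 = x n" using assms(2) by (simp add: sup_absorb1)
    ultimately show ?thesis
      using norm_triangle_ineq[of "sup l 0 - x n" "x n - l"] by (simp add: norm_minus_commute)
  qed
  moreover have "(\<lambda>n. 2 * norm (x n - l)) \<longlonglongrightarrow> 2 * 0"
    using assms(1) by (intro tendsto_intros) (simp add: LIM_zero_iff tendsto_norm_zero_iff)
  ultimately have "norm (sup l 0 - l) \<le> 0"
    using LIMSEQ_le_const[of "\<lambda>n. 2 * norm (x n - l)" "2 * 0" "norm (sup l 0 - l)"] by simp
  then show ?thesis by (metis diff_eq_diff_eq norm_le_zero_iff right_minus_eq sup_ge2)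
qed

lemma tendsto_le_lattice:
  fixes x :: "nat \<Rightarrow> 'a::banach_lattice"
  assumes "x \<longlonglongrightarrow> l" "y \<longlonglongrightarrow> m" "\<And>n. x n \<le> y n" shows "l \<le> m"
  using tendsto_nonneg_lattice[OF tendsto_diff[OF assms(2,1)]] assms(3) by simp

lemma lattice_archimedean:
  fixes z w :: "'a::banach_lattice"
  assumes "\<And>n. real (Suc n) *\<^sub>R z \<le> w" shows "z \<le> 0"
proof -
  have "z \<le> inverse (real (Suc n)) *\<^sub>R w" for n
    using scaleR_left_mono[OF assms[of n], of "inverse (real (Suc n))"] by simp
  moreover have "(\<lambda>n. inverse (real (Suc n)) *\<^sub>R w) \<longlonglongrightarrow> 0 *\<^sub>R w"
    by (intro tendsto_intros LIMSEQ_inverse_real_of_nat)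
  ultimately have "z \<le> 0 *\<^sub>R w"
    using tendsto_le_lattice[OF tendsto_const[of z], of _ "0 *\<^sub>R w"] by blast
  then show ?thesis by simp
qed

text \<open>One inequality holds for every scalar; the other is the same inequality for
  \<open>inverse t\<close>.\<close>

lemma abs_scaleR_lattice: "\<bar>t *\<^sub>R x\<bar> = \<bar>t\<bar> *\<^sub>R \<bar>x::'a::banach_lattice\<bar>"
proof -
  have le: "\<bar>t *\<^sub>R x\<bar> \<le> \<bar>t\<bar> *\<^sub>R \<bar>x\<bar>" for t and x :: 'a
  proof (cases "0 \<le> t")
    case True
    then show ?thesis
      using scaleR_left_mono[OF abs_ge_self[of x] True] scaleR_left_mono[OF abs_ge_minus_self[of x] True]
      by (intro abs_leI) auto
  next
    case False
    then have "0 \<le> - t" by simp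
    with False show ?thesis
      using scaleR_left_mono[OF abs_ge_self[of x] \<open>0 \<le> - t\<close>]
        scaleR_left_mono[OF abs_ge_minus_self[of x] \<open>0 \<le> - t\<close>]
      by (intro abs_leI) auto
  qed
  show ?thesis
  proof (cases "t = 0")
    case False
    have "\<bar>x\<bar> \<le> \<bar>inverse t\<bar> *\<^sub>R \<bar>t *\<^sub>R x\<bar>"
      using le[of "inverse t" "t *\<^sub>R x"] False by simp
    from scaleR_left_mono[OF this abs_ge_zero[of t]]
    have "\<bar>t\<bar> *\<^sub>R \<bar>x\<bar> \<le> \<bar>t *\<^sub>R x\<bar>" using False by simp
    with le show ?thesis by (rule antisym)
  qed simp
qed

lemma abs_sum_le_lattice:
  fixes f :: "'i \<Rightarrow> 'a::banach_lattice"
  shows "\<bar>\<Sum>i\<in>A. f i\<bar> \<le> (\<Sum>i\<in>A. \<bar>f i\<bar>)"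
  by (induct A rule: infinite_finite_induct) (auto intro: order_trans[OF abs_triangle_ineq] add_left_mono)

section \<open>Disjoint elements\<close>

lemma inf_scaleR_lattice:
  fixes x y :: "'a::banach_lattice"
  assumes "0 \<le> x" "0 \<le> y" "inf x y = 0" "0 \<le> t" shows "inf (t *\<^sub>R x) y = 0"
proof (rule antisym)
  \<comment> \<open>This \<open>c\<close> dominates the scalars of both arguments, so dividing the
    infimum by \<open>c\<close> puts it below \<open>inf x y\<close>.\<close>
  define c where "c = max 1 t"
  have c: "1 \<le> c" "t \<le> c" by (auto simp: c_def)
  have "t *\<^sub>R x \<le> c *\<^sub>R x" "y \<le> c *\<^sub>R y"
    using scaleR_right_mono[OF c(2) assms(1)] scaleR_right_mono[OF c(1) assms(2)] by auto
  then have "inf (t *\<^sub>R x) y \<le> c *\<^sub>R x" "inf (t *\<^sub>R x) y \<le> c *\<^sub>R y"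
    by (meson inf.coboundedI1 inf.coboundedI2)+
  from this[THEN scaleR_left_mono, of "inverse c"] c
  have "inverse c *\<^sub>R inf (t *\<^sub>R x) y \<le> inf x y" by (intro inf_greatest) auto
  then have "c *\<^sub>R (inverse c *\<^sub>R inf (t *\<^sub>R x) y) \<le> c *\<^sub>R 0"
    using c assms(3) by (intro scaleR_left_mono) auto
  then show "inf (t *\<^sub>R x) y \<le> 0" using c by simp
qed (use assms in \<open>auto intro!: scaleR_nonneg_nonneg\<close>)

text \<open>Subtracting \<open>y\<close> from the infimum leaves an element below both
  \<open>x\<close> and \<open>z\<close>, hence below 0; so the infimum is already below
  \<open>inf y z\<close>.\<close>

lemma inf_add_lattice:
  fixes x y z :: "'a::banach_lattice"
  assumes "0 \<le> x" "0 \<le> y" "0 \<le> z" "inf x z = 0" "inf y z = 0" shows "inf (x + y) z = 0"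
proof (rule antisym)
  let ?w = "inf (x + y) z"
  have "?w - y \<le> x" by (simp add: algebra_simps)
  moreover have "?w - y \<le> z" using assms(2) by (simp add: algebra_simps add_increasing le_infI2)
  ultimately have "?w - y \<le> 0" using assms(4) by (metis le_inf_iff)
  then have "?w \<le> inf y z" by simp
  then show "?w \<le> 0" using assms(5) by simp
qed (use assms in auto)

lemma disjoint_elements_commute: "disjoint_elements x y \<longleftrightarrow> disjoint_elements y x"
  unfolding disjoint_elements_def by (subst inf_commute) (rule refl)

lemma disjoint_elements_add:
  assumes "disjoint_elements x z" "disjoint_elements y z" shows "disjoint_elements (x + y) z"
  unfolding disjoint_elements_def
proof (rule antisym)
  have "inf \<bar>x + y\<bar> \<bar>z\<bar> \<le> inf (\<bar>x\<bar> + \<bar>y\<bar>) \<bar>z\<bar>"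
    by (intro inf_mono abs_triangle_ineq order_refl)
  also have "\<dots> = 0" using assms by (intro inf_add_lattice) (auto simp: disjoint_elements_def)
  finally show "inf \<bar>x + y\<bar> \<bar>z\<bar> \<le> 0" .
qed auto

lemma disjoint_elements_scaleR: "disjoint_elements x z \<Longrightarrow> disjoint_elements (t *\<^sub>R x) z"
  unfolding disjoint_elements_def abs_scaleR_lattice by (rule inf_scaleR_lattice) auto

lemma disjoint_elements_sum:
  assumes "\<And>i. i \<in> A \<Longrightarrow> disjoint_elements (x i) z"
  shows "disjoint_elements (\<Sum>i\<in>A. x i) z"
  using assms by (induct A rule: infinite_finite_induct)
    (auto intro: disjoint_elements_add simp: disjoint_elements_def[of 0] inf_absorb1)

text \<open>For disjoint elements the sum of the moduli is their supremum. Twice this supremum is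
  the supremum of the three pairwise sums of the moduli, and the triangle inequality bounds each of
  these by the modulus of \<open>x + y\<close> plus both moduli.\<close>

lemma disjoint_elements_abs_add:
  assumes "disjoint_elements x y" shows "\<bar>x\<bar> + \<bar>y\<bar> \<le> \<bar>x + y\<bar>"
proof -
  have 1: "\<bar>x\<bar> \<le> \<bar>x + y\<bar> + \<bar>y\<bar>" using abs_triangle_ineq[of "x + y" "- y"] by simp
  have 2: "\<bar>y\<bar> \<le> \<bar>x + y\<bar> + \<bar>x\<bar>" using abs_triangle_ineq[of "x + y" "- x"] by simp
  have "\<bar>x\<bar> + \<bar>y\<bar> = sup \<bar>x\<bar> \<bar>y\<bar>"
    using assms add_eq_inf_sup[of "\<bar>x\<bar>" "\<bar>y\<bar>"] by (simp add: disjoint_elements_def)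
  moreover have "sup \<bar>x\<bar> \<bar>y\<bar> + (\<bar>x\<bar> + \<bar>y\<bar>) \<le> \<bar>x + y\<bar> + (\<bar>x\<bar> + \<bar>y\<bar>)" if "sup \<bar>x\<bar> \<bar>y\<bar> = \<bar>x\<bar> + \<bar>y\<bar>"
  proof -
    have "\<bar>x\<bar> + \<bar>x\<bar> - \<bar>x + y\<bar> \<le> \<bar>x\<bar> + \<bar>y\<bar>" "\<bar>y\<bar> + \<bar>y\<bar> - \<bar>x + y\<bar> \<le> \<bar>x\<bar> + \<bar>y\<bar>"
      using 1 2 by (auto simp: algebra_simps)
    then have "\<bar>x\<bar> + \<bar>x\<bar> \<le> \<bar>x + y\<bar> + (\<bar>x\<bar> + \<bar>y\<bar>)" "\<bar>y\<bar> + \<bar>y\<bar> \<le> \<bar>x + y\<bar> + (\<bar>x\<bar> + \<bar>y\<bar>)"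
      by (auto simp: algebra_simps)
    moreover have "\<bar>x\<bar> + \<bar>y\<bar> \<le> \<bar>x + y\<bar> + (\<bar>x\<bar> + \<bar>y\<bar>)" by simp
    ultimately have "sup (\<bar>x\<bar> + \<bar>x\<bar>) (sup (\<bar>x\<bar> + \<bar>y\<bar>) (\<bar>y\<bar> + \<bar>y\<bar>)) \<le> \<bar>x + y\<bar> + (\<bar>x\<bar> + \<bar>y\<bar>)" by simp
    moreover have "sup \<bar>x\<bar> \<bar>y\<bar> + sup \<bar>x\<bar> \<bar>y\<bar> = sup (\<bar>x\<bar> + \<bar>x\<bar>) (sup (\<bar>x\<bar> + \<bar>y\<bar>) (\<bar>y\<bar> + \<bar>y\<bar>))"
      by (simp add: add_sup_inf_distribs ac_simps)
    ultimately show ?thesis using that by simp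
  qed
  ultimately show ?thesis by simp
qed

text \<open>Reverse triangle inequality, by induction: each new term is disjoint from the sum of the
  earlier ones.\<close>

lemma disjoint_sum_abs:
  assumes "finite A" "\<And>i j. i \<in> A \<Longrightarrow> j \<in> A \<Longrightarrow> i \<noteq> j \<Longrightarrow> disjoint_elements (x i) (x j)"
  shows "(\<Sum>i\<in>A. \<bar>x i\<bar>) \<le> \<bar>\<Sum>i\<in>A. x i\<bar>"
  using assms
proof (induct A rule: finite_induct)
  case (insert a A)
  have "disjoint_elements (\<Sum>i\<in>A. x i) (x a)"
    using insert by (intro disjoint_elements_sum) blast
  then have "\<bar>x a\<bar> + \<bar>\<Sum>i\<in>A. x i\<bar> \<le> \<bar>x a + (\<Sum>i\<in>A. x i)\<bar>"
    by (intro disjoint_elements_abs_add) (simp add: disjoint_elements_commute)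
  moreover have "\<bar>x a\<bar> + (\<Sum>i\<in>A. \<bar>x i\<bar>) \<le> \<bar>x a\<bar> + \<bar>\<Sum>i\<in>A. x i\<bar>"
    using insert by (intro add_left_mono) blast
  ultimately have "\<bar>x a\<bar> + (\<Sum>i\<in>A. \<bar>x i\<bar>) \<le> \<bar>x a + (\<Sum>i\<in>A. x i)\<bar>" by (rule order_trans[rotated])
  then show ?case using insert(1,2) by simp
qed simp

section \<open>Positive functionals and operators\<close>

lemma positive_norming_functional:
  fixes a :: "'a::banach_lattice"
  assumes "0 \<le> a"
  obtains h where "bounded_linear h" "\<And>x. 0 \<le> x \<Longrightarrow> 0 \<le> h x" "\<And>x. \<bar>h x\<bar> \<le> norm x" "h a = norm a"
proof -
  \<comment> \<open>The norm of the positive part vanishes on negative elements, so any linear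
    functional below it is positive; at \<open>a\<close> it equals \<open>norm a\<close>.\<close>
  define p where "p x = norm (sup x 0)" for x :: 'a
  have "sublinear p"
  proof (rule sublinearI)
    fix x y :: 'a
    have "sup (x + y) 0 \<le> sup x 0 + sup y 0"
      by (auto intro!: add_mono add_nonneg_nonneg)
    then show "p (x + y) \<le> p x + p y"
      unfolding p_def by (intro order_trans[OF banach_lattice_norm_mono norm_triangle_ineq]) auto
  next
    fix t :: real and x :: 'a assume "0 < t"
    then have "sup (t *\<^sub>R x) 0 \<le> t *\<^sub>R sup x 0"
      by (intro sup_least scaleR_left_mono scaleR_nonneg_nonneg) auto
    then show "p (t *\<^sub>R x) \<le> t * p x"
      unfolding p_def using banach_lattice_norm_mono[of "sup (t *\<^sub>R x) 0" "t *\<^sub>R sup x 0"] \<open>0 < t\<close> by simp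
  qed (simp add: p_def)
  then obtain h where h: "linear h" "\<And>x. h x \<le> p x" "h a = p a"
    using Hahn_Banach_support[of p a] by blast
  have hn: "h x \<le> norm x" for x using h(2)[of x] norm_pos_part_le[of x] by (simp add: p_def)
  have "0 \<le> h x" if "0 \<le> x" for x
    using h(2)[of "- x"] that linear_neg[OF h(1), of x] by (simp add: p_def sup_absorb2)
  with that[of h] show thesis
    using dominated_linear_bounded[of h 1] h hn assms by (simp add: p_def sup_absorb1)
qed

lemma positive_linear_mono:
  fixes T :: "'x::banach_lattice \<Rightarrow> 'y::banach_lattice"
  assumes "linear T" "\<And>x. 0 \<le> x \<Longrightarrow> 0 \<le> T x" "x \<le> y"
  shows "T x \<le> T y"
  using assms(2)[of "y - x"] assms(3) by (simp add: linear_diff[OF assms(1)])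

lemma positive_linear_abs:
  fixes T :: "'x::banach_lattice \<Rightarrow> 'y::banach_lattice"
  assumes T: "linear T" "\<And>x. 0 \<le> x \<Longrightarrow> 0 \<le> T x"
  shows "\<bar>T x\<bar> \<le> T \<bar>x\<bar>"
  using positive_linear_mono[OF T abs_ge_self[of x]] positive_linear_mono[OF T abs_ge_minus_self[of x]]
  by (intro abs_leI) (auto simp: linear_neg[OF T(1)])

text \<open>If \<open>T\<close> were unbounded on the positive part of the unit ball, points with
  \<open>norm (T (x n))\<close> above \<open>4 ^ n\<close> could be summed with weights
  \<open>(1/2) ^ n\<close>. The sum dominates every term, so its image would have norm above
  \<open>2 ^ n\<close> for all \<open>n\<close>.\<close>

lemma positive_linear_bounded:
  fixes T :: "'x::banach_lattice \<Rightarrow> 'y::banach_lattice"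
  assumes T: "linear T" and pos: "\<And>x. 0 \<le> x \<Longrightarrow> 0 \<le> T x"
  shows "bounded_linear T"
proof -
  have "\<exists>K. \<forall>x. 0 \<le> x \<longrightarrow> norm x \<le> 1 \<longrightarrow> norm (T x) \<le> K"
  proof (rule ccontr)
    assume "\<nexists>K. \<forall>x. 0 \<le> x \<longrightarrow> norm x \<le> 1 \<longrightarrow> norm (T x) \<le> K"
    then have "\<forall>n. \<exists>x. 0 \<le> x \<and> norm x \<le> 1 \<and> 4 ^ n < norm (T x)"
      by (meson not_le)
    then obtain x where x: "\<And>n. 0 \<le> x n" "\<And>n. norm (x n) \<le> 1" "\<And>n. 4 ^ n < norm (T (x n))"
      by metis
    define y where "y n = (1/2) ^ n *\<^sub>R x n" for n :: nat
    have y0: "0 \<le> y n" for n using x(1) by (simp add: y_def scaleR_nonneg_nonneg)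
    have "norm (y n) \<le> (1/2) ^ n" for n
      using mult_left_mono[OF x(2), of "(1/2) ^ n" n] by (simp add: y_def)
    then have sy: "summable y" by (intro summable_comparison_test'[OF summable_geometric]) auto
    have ysum: "y n \<le> suminf y" for n
    proof (rule tendsto_le_lattice[OF tendsto_const])
      show "(\<lambda>m. sum y {..<m + Suc n}) \<longlonglongrightarrow> suminf y"
        using summable_LIMSEQ[OF sy] by (rule LIMSEQ_ignore_initial_segment)
      fix m
      have "sum y {n} \<le> sum y {..<m + Suc n}" by (intro sum_mono2) (auto simp: y0)
      then show "y n \<le> sum y {..<m + Suc n}" by simp
    qed
    have "2 ^ n < norm (T (suminf y))" for n
    proof -
      have "2 ^ n * 2 ^ n < norm (T (x n))"
        using x(3)[of n] by (simp flip: power_mult_distrib)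
      then have "2 ^ n < norm (T (y n))"
        by (simp add: y_def linear_scale[OF T] power_one_over field_simps)
      also have "\<dots> \<le> norm (T (suminf y))"
        by (intro banach_lattice_norm_mono pos y0 positive_linear_mono[OF T pos] ysum)
      finally show ?thesis .
    qed
    moreover obtain n where "norm (T (suminf y)) < 2 ^ n"
      using real_arch_pow[of 2 "norm (T (suminf y))"] by auto
    ultimately show False by (meson order_less_asym)
  qed
  then obtain K where K: "\<And>x. 0 \<le> x \<Longrightarrow> norm x \<le> 1 \<Longrightarrow> norm (T x) \<le> K" by blast
  have "norm (T x) \<le> norm x * K" for x
  proof (cases "x = 0")
    case False
    have "norm (T x) \<le> norm (T \<bar>x\<bar>)"
      using norm_mono_abs[of "T x" "T \<bar>x\<bar>"] positive_linear_abs[OF T pos, of x] pos[of "\<bar>x\<bar>"] by simp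
    also have "T \<bar>x\<bar> = norm x *\<^sub>R T (inverse (norm x) *\<^sub>R \<bar>x\<bar>)"
      using False by (simp add: linear_scale[OF T])
    also have "norm \<dots> \<le> norm x * K"
      using K[of "inverse (norm x) *\<^sub>R \<bar>x\<bar>"] False
      by (simp add: scaleR_nonneg_nonneg mult_left_mono)
    finally show ?thesis .
  qed (simp add: linear_0[OF T])
  then show ?thesis using T by (intro bounded_linear_intro) (auto simp: linear_add linear_scale)
qed

subsection \<open>Order continuity and quadratic forms\<close>

text \<open>No supremum is known beforehand, so the net runs over pairs of an index \<open>n\<close>
  and an upper bound \<open>c\<close> and takes the value \<open>c - x n\<close>. It decreases to
  zero by the Archimedean property, and its norm convergence makes the sequence Cauchy.\<close>

lemma order_continuous_mono_convergent:
  fixes x :: "nat \<Rightarrow> 'a::banach_lattice"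
  assumes oc: "order_continuous TYPE('a)" and inc: "\<And>n. x n \<le> x (Suc n)" and bd: "\<And>n. x n \<le> b"
  shows "\<exists>l. x \<longlonglongrightarrow> l"
proof -
  define I where "I = (UNIV :: nat set) \<times> {c. \<forall>n. x n \<le> c}"
  define le where "le = (\<lambda>(n :: nat, c :: 'a) (m :: nat, d :: 'a). n \<le> m \<and> d \<le> c)"
  define y where "y = (\<lambda>(n, c). c - x n)"
  have mono: "x n \<le> x m" if "n \<le> m" for n m using that inc by (rule lift_Suc_mono_le[rotated])
  have "directed_preorder I le"
    unfolding directed_preorder_def
  proof (intro conjI ballI impI)
    show "I \<noteq> {}" using bd by (auto simp: I_def)
    fix i j assume "i \<in> I" "j \<in> I"
    then obtain n c m d where "i = (n, c)" "j = (m, d)" "\<And>k. x k \<le> c" "\<And>k. x k \<le> d"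
      by (auto simp: I_def)
    then show "\<exists>k\<in>I. le i k \<and> le j k"
      by (intro bexI[of _ "(max n m, inf c d)"]) (auto simp: I_def le_def)
  qed (auto simp: le_def)
  moreover have "net_decreasing_to_zero I le y"
    unfolding net_decreasing_to_zero_def
  proof (intro conjI ballI impI allI)
    fix z assume z: "\<forall>i\<in>I. z \<le> y i"
    \<comment> \<open>A lower bound \<open>z\<close> of the net can be subtracted from any upper
      bound of the sequence, giving another upper bound; iterating from \<open>b\<close> bounds all
      multiples of \<open>z\<close>.\<close>
    have step: "x n \<le> c - z" if "\<And>n. x n \<le> c" for c n
      using z[rule_format, of "(n, c)"] that by (simp add: I_def y_def algebra_simps)
    have ub: "x n \<le> b - real k *\<^sub>R z" for n k
    proof (induct k arbitrary: n)
      case (Suc k)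
      then show ?case using step[OF Suc] by (simp add: algebra_simps)
    qed (simp add: bd)
    then have "real (Suc k) *\<^sub>R z \<le> b - x 0" for k
      using ub[of 0 "Suc k"] by (metis le_diff_eq add.commute)
    then show "z \<le> 0" by (rule lattice_archimedean)
  qed (auto simp: I_def le_def y_def intro: diff_mono mono)
  ultimately have null: "net_norm_null I le y" by (rule order_continuous_net[OF oc])
  have "Cauchy x"
  proof (rule CauchyI)
    fix e :: real assume "0 < e"
    then obtain i where i: "i \<in> I" "\<And>j. j \<in> I \<Longrightarrow> le i j \<Longrightarrow> norm (y j) < e / 2"
      using null unfolding net_norm_null_def by (meson half_gt_zero)
    obtain N c where ic: "i = (N, c)" "\<And>k. x k \<le> c" using i(1) by (auto simp: I_def)
    \<comment> \<open>The bound \<open>c\<close> stays fixed while the index grows, so all late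
      terms lie near one element.\<close>
    have "norm (c - x n) < e / 2" if "N \<le> n" for n
      using i(2)[of "(n, c)"] that ic by (auto simp: I_def le_def y_def)
    note near = this
    have "norm (x m - x n) < e" if "N \<le> m" "N \<le> n" for m n
    proof -
      have "norm (x m - x n) = norm ((c - x n) - (c - x m))" by simp
      also have "\<dots> \<le> norm (c - x n) + norm (c - x m)" by (rule norm_triangle_ineq4)
      also have "\<dots> < e" using near[OF that(1)] near[OF that(2)] by linarith
      finally show ?thesis .
    qed
    then show "\<exists>M. \<forall>m\<ge>M. \<forall>n\<ge>M. norm (x m - x n) < e" by blast
  qed
  then show ?thesis by (simp add: Cauchy_convergent_iff convergent_def)
qed

section \<open>Countable suprema and the control functional\<close>

primrec partial_sup :: "(nat \<Rightarrow> 'a::sup) \<Rightarrow> nat \<Rightarrow> 'a" where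
  "partial_sup a 0 = a 0"
| "partial_sup a (Suc n) = sup (partial_sup a n) (a (Suc n))"

lemma partial_sup_upper: "k \<le> n \<Longrightarrow> a k \<le> partial_sup (a :: nat \<Rightarrow> 'a::lattice) n"
  by (induct n) (auto simp: le_Suc_eq intro: le_supI1)

lemma partial_sup_least: "(\<And>k. a k \<le> b) \<Longrightarrow> partial_sup (a :: nat \<Rightarrow> 'a::lattice) n \<le> b"
  by (induct n) auto

text \<open>Lets a positive functional of a supremum be estimated by a series.\<close>

lemma partial_sup_le_sum:
  fixes a :: "nat \<Rightarrow> 'a::banach_lattice"
  assumes "\<And>k. 0 \<le> a k" shows "partial_sup a n \<le> (\<Sum>k\<le>n. a k)"
proof (induct n)
  case (Suc n)
  have "a (Suc n) \<le> (\<Sum>k\<le>Suc n. a k)" using assms by (simp add: sum_nonneg)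
  moreover have "partial_sup a n \<le> (\<Sum>k\<le>Suc n. a k)" using Suc assms by (simp add: add_increasing2)
  ultimately show ?case by simp
qed simp

text \<open>The partial suprema increase and are bounded, hence converge in norm; since the order is
  closed, the limit is the least upper bound.\<close>

lemma order_continuous_countable_lub:
  fixes a :: "nat \<Rightarrow> 'a::banach_lattice"
  assumes oc: "order_continuous TYPE('a)" and bd: "\<And>n. a n \<le> b"
  shows "\<exists>g. partial_sup a \<longlonglongrightarrow> g \<and> (\<forall>n. a n \<le> g) \<and> (\<forall>c. (\<forall>n. a n \<le> c) \<longrightarrow> g \<le> c)"
proof -
  obtain g where g: "partial_sup a \<longlonglongrightarrow> g"
    using order_continuous_mono_convergent[OF oc, of "partial_sup a"] partial_sup_least[of a, OF bd] by auto
  have "a n \<le> g" for n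
    using partial_sup_upper[of n _ a]
    by (intro tendsto_le_lattice[OF tendsto_const[of "a n"] LIMSEQ_ignore_initial_segment[OF g, of n]]) simp
  moreover have "g \<le> c" if "\<forall>n. a n \<le> c" for c
    using partial_sup_least[of a c] that by (intro tendsto_le_lattice[OF g tendsto_const[of c]]) auto
  ultimately show ?thesis using g by blast
qed

text \<open>Otherwise every positive functional is arbitrarily small at some point of
  \<open>[0, u]\<close> of norm above \<open>e\<close>. Adding a norming functional for each such
  point before choosing the next gives increasing \<open>F n\<close> with \<open>F n (x n)\<close>
  below \<open>(1/2) ^ n\<close>. The suprema of the tails of \<open>x\<close> decrease to a limit
  on which every \<open>F n\<close> is nonpositive, yet they keep distance at least \<open>e\<close>
  from it.\<close>

lemma order_continuous_control_functional:
  fixes u :: "'a::banach_lattice"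
  assumes oc: "order_continuous TYPE('a)" and u: "0 \<le> u" and e: "0 < e"
  shows "\<exists>(f :: 'a \<Rightarrow> real) \<delta>. bounded_linear f \<and> (\<forall>x\<ge>0. 0 \<le> f x) \<and> 0 < \<delta> \<and>
    (\<forall>x. 0 \<le> x \<longrightarrow> x \<le> u \<longrightarrow> f x < \<delta> \<longrightarrow> norm x \<le> (e::real))"
proof (rule ccontr)
  assume no: "\<not> ?thesis"
  have ex: "\<exists>x. 0 \<le> x \<and> x \<le> u \<and> f x < \<delta> \<and> e < norm x"
    if "bounded_linear f" "\<And>x. 0 \<le> x \<Longrightarrow> 0 \<le> f x" "0 < \<delta>" for f :: "'a \<Rightarrow> real" and \<delta>
  proof (rule ccontr)
    assume "\<not> ?thesis"
    then have "\<forall>x. 0 \<le> x \<longrightarrow> x \<le> u \<longrightarrow> f x < \<delta> \<longrightarrow> norm x \<le> e"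
      using linorder_not_le by blast
    with no that show False by blast
  qed
  \<comment> \<open>A state is a positive functional together with a point where it is small
    although the norm is large. \<open>R\<close> keeps the inequalities needed later: the next
    functional dominates the present one and one that norms the present point.\<close>
  define P where "P n Fx \<longleftrightarrow> (case Fx of (F, x) \<Rightarrow> bounded_linear F \<and> (\<forall>z\<ge>0. 0 \<le> F z) \<and>
      0 \<le> x \<and> x \<le> u \<and> F x < (1/2) ^ n \<and> e < norm x)" for n :: nat and Fx :: "('a \<Rightarrow> real) \<times> 'a"
  define R where "R Fx Gy \<longleftrightarrow> (case Fx of (F, x) \<Rightarrow> case Gy of (G, y) \<Rightarrow>
      (\<forall>z\<ge>0. F z \<le> G z) \<and> (\<exists>h. bounded_linear h \<and> (\<forall>z\<ge>0. 0 \<le> h z) \<and> (\<forall>z. \<bar>h z\<bar> \<le> norm z) \<and> h x = norm x \<and>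
        (\<forall>z\<ge>0. h z \<le> G z)))" for Fx Gy :: "('a \<Rightarrow> real) \<times> 'a"
  have "\<exists>s. \<forall>n. P n (s n) \<and> R (s n) (s (Suc n))"
  proof (rule dependent_nat_choice)
    obtain x where "0 \<le> x" "x \<le> u" "e < norm x"
      using ex[of "\<lambda>_. 0" 1] by (auto simp: bounded_linear_zero)
    then have "P 0 (\<lambda>_. 0, x)" by (simp add: P_def bounded_linear_zero)
    then show "\<exists>Fx. P 0 Fx" by blast
  next
    fix Fx n assume P: "P n Fx"
    obtain F x where Fx: "Fx = (F, x)" by fastforce
    obtain h where h: "bounded_linear h" "\<And>z. 0 \<le> z \<Longrightarrow> 0 \<le> h z" "\<And>z. \<bar>h z\<bar> \<le> norm z" "h x = norm x"
      using positive_norming_functional[of x] P by (auto simp: P_def Fx)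
    define G where "G z = F z + h z" for z
    have G: "bounded_linear G" "\<And>z. 0 \<le> z \<Longrightarrow> 0 \<le> G z" "\<And>z. 0 \<le> z \<Longrightarrow> F z \<le> G z" "\<And>z. 0 \<le> z \<Longrightarrow> h z \<le> G z"
      using P h(1,2) unfolding G_def P_def Fx by (auto intro: bounded_linear_add)
    then obtain y where y: "0 \<le> y" "y \<le> u" "G y < (1/2) ^ Suc n" "e < norm y"
      using ex[of G "(1/2) ^ Suc n"] by auto
    have "P (Suc n) (G, y)" using G y unfolding P_def by auto
    moreover have "R Fx (G, y)" using G h unfolding R_def Fx by auto
    ultimately show "\<exists>Gy. P (Suc n) Gy \<and> R Fx Gy" by blast
  qed
  then obtain s where s: "\<And>n. P n (s n)" "\<And>n. R (s n) (s (Suc n))" by blast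
  define F x where "F n = fst (s n)" and "x n = snd (s n)" for n
  have F: "bounded_linear (F n)" "\<And>z. 0 \<le> z \<Longrightarrow> 0 \<le> F n z"
    and x: "0 \<le> x n" "x n \<le> u" "F n (x n) < (1/2) ^ n" "e < norm (x n)" for n
    using s(1)[of n] by (auto simp: P_def F_def x_def split: prod.splits)
  have FS: "F n z \<le> F (Suc n) z" if "0 \<le> z" for n z
    using s(2)[of n] that by (auto simp: R_def F_def split: prod.splits)
  have Fle: "F n z \<le> F m z" if "n \<le> m" "0 \<le> z" for n m z
    using FS[OF that(2)] that(1) by (rule lift_Suc_mono_le)
  have "\<exists>h. bounded_linear h \<and> (\<forall>z\<ge>0. 0 \<le> h z) \<and> (\<forall>z. \<bar>h z\<bar> \<le> norm z) \<and> h (x n) = norm (x n) \<and>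
        (\<forall>z\<ge>0. h z \<le> F (Suc n) z)" for n
    using s(2)[of n] unfolding R_def F_def x_def by (auto split: prod.splits)
  then obtain h where h: "\<And>n. bounded_linear (h n)" "\<And>n z. 0 \<le> z \<Longrightarrow> 0 \<le> h n z"
      "\<And>n z. \<bar>h n z\<bar> \<le> norm z" "\<And>n. h n (x n) = norm (x n)" "\<And>n z. 0 \<le> z \<Longrightarrow> h n z \<le> F (Suc n) z"
    by metis
  have "\<forall>n. \<exists>g. partial_sup (\<lambda>k. x (n + k)) \<longlonglongrightarrow> g \<and> (\<forall>k. x (n + k) \<le> g) \<and>
      (\<forall>c. (\<forall>k. x (n + k) \<le> c) \<longrightarrow> g \<le> c)"
    using x(2) by (intro allI order_continuous_countable_lub[OF oc]) blast
  then obtain g where g: "\<And>n. partial_sup (\<lambda>k. x (n + k)) \<longlonglongrightarrow> g n" "\<And>n k. x (n + k) \<le> g n"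
      "\<And>n c. (\<And>k. x (n + k) \<le> c) \<Longrightarrow> g n \<le> c" by metis
  have g0: "0 \<le> g n" for n using x(1)[of n] g(2)[of n 0] by simp
  have gS: "- g n \<le> - g (Suc n)" for n
    using g(3)[of "Suc n" "g n"] g(2)[of n "Suc _"] by simp
  obtain l' where l': "(\<lambda>n. - g n) \<longlonglongrightarrow> l'"
    using order_continuous_mono_convergent[OF oc, of "\<lambda>n. - g n" 0] gS g0 by auto
  define l where "l = - l'"
  have l: "g \<longlonglongrightarrow> l" using tendsto_minus[OF l'] by (simp add: l_def)
  have l0: "0 \<le> l" using tendsto_nonneg_lattice[OF l g0] .
  \<comment> \<open>From index \<open>i\<close> on, \<open>F i\<close> lies below
    \<open>F (n + k)\<close> on the cone, so its values on the tail are dominated by a geometric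
    series.\<close>
  have Fg: "F i (g n) \<le> 2 * (1/2) ^ n" if "i \<le> n" for i n
  proof -
    have "F i (partial_sup (\<lambda>k. x (n + k)) N) \<le> 2 * (1/2) ^ n" for N
    proof -
      interpret Fi: bounded_linear "F i" by (rule F)
      have "F i (partial_sup (\<lambda>k. x (n + k)) N) \<le> F i (\<Sum>k\<le>N. x (n + k))"
        using F(2)[of "(\<Sum>k\<le>N. x (n + k)) - partial_sup (\<lambda>k. x (n + k)) N" i]
          partial_sup_le_sum[of "\<lambda>k. x (n + k)" N] x(1) by (simp add: Fi.diff)
      also have "\<dots> = (\<Sum>k\<le>N. F i (x (n + k)))" by (rule Fi.sum)
      also have "\<dots> \<le> (\<Sum>k\<le>N. (1/2) ^ (n + k))"
      proof (intro sum_mono)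
        fix k
        have "F i (x (n + k)) \<le> F (n + k) (x (n + k))" using that by (intro Fle x(1)) simp
        then show "F i (x (n + k)) \<le> (1/2) ^ (n + k)" using x(3)[of "n + k"] by simp
      qed
      also have "\<dots> = (1/2) ^ n * (\<Sum>k\<le>N. (1/2) ^ k)" by (simp add: power_add sum_distrib_left)
      also have "\<dots> \<le> (1/2) ^ n * 2"
        using geometric_sum[of "1/2::real" "Suc N"]
        by (intro mult_left_mono) (auto simp: lessThan_Suc_atMost)
      finally show ?thesis by simp
    qed
    moreover have "(\<lambda>N. F i (partial_sup (\<lambda>k. x (n + k)) N)) \<longlonglongrightarrow> F i (g n)"
      by (rule bounded_linear.tendsto[OF F(1) g(1)])
    ultimately show ?thesis by (intro LIMSEQ_le_const2) auto
  qed
  have Fl: "F i l \<le> 0" for i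
  proof -
    have "(\<lambda>n. F i (g (n + i))) \<longlonglongrightarrow> F i l"
      by (rule LIMSEQ_ignore_initial_segment[OF bounded_linear.tendsto[OF F(1) l]])
    moreover have "(\<lambda>n. 2 * (1/2) ^ (n + i)) \<longlonglongrightarrow> 2 * (0::real)"
      by (intro tendsto_intros LIMSEQ_ignore_initial_segment LIMSEQ_power_zero) auto
    ultimately have "F i l \<le> 2 * 0" by (rule LIMSEQ_le) (use Fg in auto)
    then show ?thesis by simp
  qed
  \<comment> \<open>The functional \<open>h n\<close> norms \<open>x n\<close>, which lies below
    \<open>g n\<close>, and being dominated by \<open>F (Suc n)\<close> it is nonpositive at
    \<open>l\<close>.\<close>
  have "e \<le> norm (g n - l)" for n
  proof -
    interpret hn: bounded_linear "h n" by (rule h)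
    have "e < h n (x n)" using x(4) h(4) by simp
    also have "\<dots> \<le> h n (g n)" using h(2)[of "g n - x n" n] g(2)[of n 0] by (simp add: hn.diff)
    also have "\<dots> \<le> h n (g n - l)" using h(5)[OF l0, of n] Fl[of "Suc n"] by (simp add: hn.diff)
    also have "\<dots> \<le> norm (g n - l)" using h(3)[of n "g n - l"] by simp
    finally show ?thesis by simp
  qed
  moreover have "(\<lambda>n. norm (g n - l)) \<longlonglongrightarrow> 0" using l by (simp add: LIM_zero_iff tendsto_norm_zero_iff)
  ultimately have "e \<le> 0" by (intro LIMSEQ_le_const) auto
  with e show False by simp
qed

section \<open>Squares relative to a positive element\<close>

definition principal_ideal :: "'a::banach_lattice \<Rightarrow> 'a set" where
  "principal_ideal u = {x. \<exists>c\<ge>0. \<bar>x\<bar> \<le> c *\<^sub>R u}"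

lemma principal_idealI: "\<bar>x\<bar> \<le> c *\<^sub>R u \<Longrightarrow> 0 \<le> c \<Longrightarrow> x \<in> principal_ideal u"
  by (auto simp: principal_ideal_def)

lemma subspace_principal_ideal: "subspace (principal_ideal u)"
proof (rule subspaceI)
  show "0 \<in> principal_ideal u" by (rule principal_idealI[of _ 0]) auto
  fix x y assume "x \<in> principal_ideal u" "y \<in> principal_ideal u"
  then obtain c d where "0 \<le> c" "0 \<le> d" "\<bar>x\<bar> \<le> c *\<^sub>R u" "\<bar>y\<bar> \<le> d *\<^sub>R u" by (auto simp: principal_ideal_def)
  then show "x + y \<in> principal_ideal u"
    using order_trans[OF abs_triangle_ineq add_mono, of x "c *\<^sub>R u" y "d *\<^sub>R u"]
    by (intro principal_idealI[of _ "c + d"]) (auto simp: algebra_simps)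
next
  fix t :: real and x assume "x \<in> principal_ideal u"
  then obtain c where "0 \<le> c" "\<bar>x\<bar> \<le> c *\<^sub>R u" by (auto simp: principal_ideal_def)
  then show "t *\<^sub>R x \<in> principal_ideal u"
    using scaleR_left_mono[of "\<bar>x\<bar>" "c *\<^sub>R u" "\<bar>t\<bar>"]
    by (intro principal_idealI[of _ "\<bar>t\<bar> * c"]) (auto simp: abs_scaleR_lattice)
qed

text \<open>Completing the square: \<open>c\<^sup>2 - 2 * \<bar>t\<bar> * c + t\<^sup>2\<close> is
  nonnegative. This bounds the family whose supremum is the square of \<open>x\<close>.\<close>

lemma scaleR_square_bound:
  fixes u x :: "'a::banach_lattice"
  assumes u: "0 \<le> u" and x: "\<bar>x\<bar> \<le> c *\<^sub>R u"
  shows "(2 * t) *\<^sub>R x - t\<^sup>2 *\<^sub>R u \<le> c\<^sup>2 *\<^sub>R u"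
proof -
  have "(2 * t) *\<^sub>R x \<le> \<bar>(2 * t) *\<^sub>R x\<bar>" by (rule abs_ge_self)
  also have "\<dots> = \<bar>2 * t\<bar> *\<^sub>R \<bar>x\<bar>" by (rule abs_scaleR_lattice)
  also have "\<dots> \<le> \<bar>2 * t\<bar> *\<^sub>R c *\<^sub>R u" by (intro scaleR_left_mono x) simp
  finally have "(2 * t) *\<^sub>R x - t\<^sup>2 *\<^sub>R u \<le> (\<bar>2 * t\<bar> * c - t\<^sup>2) *\<^sub>R u" by (simp add: algebra_simps)
  also have "\<bar>2 * t\<bar> * c - t\<^sup>2 \<le> c\<^sup>2"
    using zero_le_power2[of "\<bar>t\<bar> - c"] by (simp add: power2_diff abs_mult)
  then have "(\<bar>2 * t\<bar> * c - t\<^sup>2) *\<^sub>R u \<le> c\<^sup>2 *\<^sub>R u" by (rule scaleR_right_mono[OF _ u])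
  finally show ?thesis .
qed

text \<open>Only rational \<open>t\<close> are used in \<open>x\<^sup>2 = sup\<^sub>t (2tx - t\<^sup>2u)\<close>: countable suprema are norm limits of
  their partial suprema.\<close>

lemma order_continuous_square:
  fixes u :: "'a::banach_lattice"
  assumes oc: "order_continuous TYPE('a)" and u: "0 \<le> u"
  shows "\<exists>sq. \<forall>x\<in>principal_ideal u. (\<forall>t\<in>\<rat>. (2 * t) *\<^sub>R x - t\<^sup>2 *\<^sub>R u \<le> sq x) \<and>
    (\<forall>b. (\<forall>t\<in>\<rat>. (2 * t) *\<^sub>R x - t\<^sup>2 *\<^sub>R u \<le> b) \<longrightarrow> sq x \<le> b)"
proof -
  obtain q :: "nat \<Rightarrow> real" where q: "range q = \<rat>"
    using range_from_nat_into[of \<rat>] countable_rat Rats_0 by blast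
  have "\<exists>g. (\<forall>t\<in>\<rat>. (2 * t) *\<^sub>R x - t\<^sup>2 *\<^sub>R u \<le> g) \<and>
      (\<forall>b. (\<forall>t\<in>\<rat>. (2 * t) *\<^sub>R x - t\<^sup>2 *\<^sub>R u \<le> b) \<longrightarrow> g \<le> b)" if x: "x \<in> principal_ideal u" for x
  proof -
    obtain c where "\<bar>x\<bar> \<le> c *\<^sub>R u" using x unfolding principal_ideal_def by blast
    from scaleR_square_bound[OF u this]
    obtain g where "\<forall>n. (2 * q n) *\<^sub>R x - (q n)\<^sup>2 *\<^sub>R u \<le> g"
      "\<forall>b. (\<forall>n. (2 * q n) *\<^sub>R x - (q n)\<^sup>2 *\<^sub>R u \<le> b) \<longrightarrow> g \<le> b"
      using order_continuous_countable_lub[OF oc, of "\<lambda>n. (2 * q n) *\<^sub>R x - (q n)\<^sup>2 *\<^sub>R u" "c\<^sup>2 *\<^sub>R u"] by blast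
    then show ?thesis unfolding q[symmetric] by (intro exI[of _ g]) auto
  qed
  then show ?thesis by (intro bchoice) blast
qed

text \<open>Here \<open>ge\<close> and \<open>le\<close> say that \<open>sq x\<close> is the least
  upper bound. A change of parameters gives one inequality; the other follows by applying it to
  \<open>x + y\<close> and \<open>x - y\<close>, using that doubling \<open>x\<close> multiplies
  \<open>sq x\<close> by at least 4.\<close>

lemma square_parallelogram:
  fixes u :: "'a::banach_lattice"
  assumes V: "x \<in> principal_ideal u" "y \<in> principal_ideal u"
    and ge: "\<And>x t. x \<in> principal_ideal u \<Longrightarrow> t \<in> \<rat> \<Longrightarrow> (2 * t) *\<^sub>R x - t\<^sup>2 *\<^sub>R u \<le> sq x"
    and le: "\<And>x b. x \<in> principal_ideal u \<Longrightarrow> (\<And>t. t \<in> \<rat> \<Longrightarrow> (2 * t) *\<^sub>R x - t\<^sup>2 *\<^sub>R u \<le> b) \<Longrightarrow> sq x \<le> b"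
  shows "sq (x + y) + sq (x - y) = 2 *\<^sub>R sq x + 2 *\<^sub>R sq y"
proof -
  note sub = subspace_add[OF subspace_principal_ideal] subspace_diff[OF subspace_principal_ideal]
    subspace_scale[OF subspace_principal_ideal]
  have *: "sq (x + y) + sq (x - y) \<le> 2 *\<^sub>R sq x + 2 *\<^sub>R sq y"
    if V: "x \<in> principal_ideal u" "y \<in> principal_ideal u" for x y
  proof -
    have 1: "((2 * t) *\<^sub>R (x + y) - t\<^sup>2 *\<^sub>R u) + ((2 * s) *\<^sub>R (x - y) - s\<^sup>2 *\<^sub>R u) \<le> 2 *\<^sub>R sq x + 2 *\<^sub>R sq y"
      if ts: "t \<in> \<rat>" "s \<in> \<rat>" for t s
    proof -
      \<comment> \<open>With \<open>t = a + b\<close> and \<open>s = a - b\<close> the two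
        expressions for \<open>x + y\<close> and \<open>x - y\<close> add up to twice those for
        \<open>x\<close> and \<open>y\<close>, and rationality is kept.\<close>
      define a b where "a = (t + s) / 2" and "b = (t - s) / 2"
      have t: "t = a + b" and s: "s = a - b" by (auto simp: a_def b_def field_simps)
      have ab: "a \<in> \<rat>" "b \<in> \<rat>" using ts by (auto simp: a_def b_def)
      have "((2 * t) *\<^sub>R (x + y) - t\<^sup>2 *\<^sub>R u) + ((2 * s) *\<^sub>R (x - y) - s\<^sup>2 *\<^sub>R u) =
          2 *\<^sub>R ((2 * a) *\<^sub>R x - a\<^sup>2 *\<^sub>R u) + 2 *\<^sub>R ((2 * b) *\<^sub>R y - b\<^sup>2 *\<^sub>R u)"
      proof -
        have "((2 * t) *\<^sub>R (x + y) - t\<^sup>2 *\<^sub>R u) + ((2 * s) *\<^sub>R (x - y) - s\<^sup>2 *\<^sub>R u) =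
            (2 * t + 2 * s) *\<^sub>R x + (2 * t - 2 * s) *\<^sub>R y - (t\<^sup>2 + s\<^sup>2) *\<^sub>R u"
          by (simp add: algebra_simps)
        also have "\<dots> = (2 * (2 * a)) *\<^sub>R x + (2 * (2 * b)) *\<^sub>R y - (2 * a\<^sup>2 + 2 * b\<^sup>2) *\<^sub>R u"
        proof -
          have "2 * t + 2 * s = 2 * (2 * a)" "2 * t - 2 * s = 2 * (2 * b)" "t\<^sup>2 + s\<^sup>2 = 2 * a\<^sup>2 + 2 * b\<^sup>2"
            unfolding t s by (simp_all add: power2_eq_square algebra_simps)
          then show ?thesis by simp
        qed
        finally show ?thesis by (simp add: algebra_simps)
      qed
      also have "\<dots> \<le> 2 *\<^sub>R sq x + 2 *\<^sub>R sq y"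
        by (intro add_mono scaleR_left_mono ge V ab) auto
      finally show ?thesis .
    qed
    \<comment> \<open>The suprema over \<open>t\<close> and \<open>s\<close> are taken one after the
      other.\<close>
    have "sq (x + y) \<le> 2 *\<^sub>R sq x + 2 *\<^sub>R sq y - ((2 * s) *\<^sub>R (x - y) - s\<^sup>2 *\<^sub>R u)" if "s \<in> \<rat>" for s
      using 1[OF _ that] by (intro le sub V) (simp add: le_diff_eq)
    then have "sq (x - y) \<le> 2 *\<^sub>R sq x + 2 *\<^sub>R sq y - sq (x + y)"
      by (intro le sub V) (smt (verit) le_diff_eq add.commute)
    then show ?thesis by (simp add: le_diff_eq add.commute)
  qed
  have four: "4 *\<^sub>R sq x \<le> sq (2 *\<^sub>R x)" if "x \<in> principal_ideal u" for x
  proof -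
    have "sq x \<le> (1/4) *\<^sub>R sq (2 *\<^sub>R x)"
    proof (rule le[OF that])
      fix t :: real assume "t \<in> \<rat>"
      then have "(2 * (2 * t)) *\<^sub>R (2 *\<^sub>R x) - (2 * t)\<^sup>2 *\<^sub>R u \<le> sq (2 *\<^sub>R x)"
        by (intro ge sub that) auto
      from scaleR_left_mono[OF this, of "1/4"]
      show "(2 * t) *\<^sub>R x - t\<^sup>2 *\<^sub>R u \<le> (1/4) *\<^sub>R sq (2 *\<^sub>R x)"
        by (simp add: scaleR_diff_right power2_eq_square)
    qed
    from scaleR_left_mono[OF this, of 4] show ?thesis by simp
  qed
  have "4 *\<^sub>R sq x + 4 *\<^sub>R sq y \<le> sq (2 *\<^sub>R x) + sq (2 *\<^sub>R y)" by (intro add_mono four V)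
  also have "\<dots> \<le> 2 *\<^sub>R sq (x + y) + 2 *\<^sub>R sq (x - y)"
    using *[of "x + y" "x - y"] V by (simp add: sub scaleR_2 algebra_simps)
  finally have "(1/2) *\<^sub>R (4 *\<^sub>R sq x + 4 *\<^sub>R sq y) \<le> (1/2) *\<^sub>R (2 *\<^sub>R sq (x + y) + 2 *\<^sub>R sq (x - y))"
    by (intro scaleR_left_mono) auto
  then have "2 *\<^sub>R sq x + 2 *\<^sub>R sq y \<le> sq (x + y) + sq (x - y)" by (simp add: scaleR_add_right)
  with *[OF V] show ?thesis by (rule antisym)
qed

text \<open>\<open>Q\<close> is a control functional applied to the square. The interval given by
  \<open>2 *\<^sub>R u\<close> is used because it contains sums and differences of elements of
  \<open>[-u, u]\<close>.\<close>

lemma order_continuous_quadratic_form: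
  fixes u :: "'a::banach_lattice"
  assumes oc: "order_continuous TYPE('a)" and u: "0 \<le> u" and e: "0 < (e::real)"
  obtains Q :: "'a \<Rightarrow> real" and \<eta> M where "0 < \<eta>"
    "\<And>x y. x \<in> principal_ideal u \<Longrightarrow> y \<in> principal_ideal u \<Longrightarrow> Q (x + y) + Q (x - y) = 2 * Q x + 2 * Q y"
    "\<And>x. \<bar>x\<bar> \<le> 2 *\<^sub>R u \<Longrightarrow> \<bar>Q x\<bar> \<le> M"
    "\<And>x. \<bar>x\<bar> \<le> 2 *\<^sub>R u \<Longrightarrow> Q x < \<eta> \<Longrightarrow> norm x \<le> e"
proof -
  obtain f :: "'a \<Rightarrow> real" and \<delta> where f: "bounded_linear f" "\<And>x. 0 \<le> x \<Longrightarrow> 0 \<le> f x" "0 < \<delta>"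
    "\<And>x. 0 \<le> x \<Longrightarrow> x \<le> 2 *\<^sub>R u \<Longrightarrow> f x < \<delta> \<Longrightarrow> norm x \<le> e"
    using order_continuous_control_functional[OF oc, of "2 *\<^sub>R u" e] u e
    by (auto simp: scaleR_nonneg_nonneg)
  interpret f: bounded_linear f by (rule f)
  have fmono: "f x \<le> f y" if "x \<le> y" for x y using f(2)[of "y - x"] that by (simp add: f.diff)
  obtain sq where sq: "\<forall>x\<in>principal_ideal u. (\<forall>t\<in>\<rat>. (2 * t) *\<^sub>R x - t\<^sup>2 *\<^sub>R u \<le> sq x) \<and>
    (\<forall>b. (\<forall>t\<in>\<rat>. (2 * t) *\<^sub>R x - t\<^sup>2 *\<^sub>R u \<le> b) \<longrightarrow> sq x \<le> b)"
    using order_continuous_square[OF oc u] by (rule exE)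
  have ge: "(2 * t) *\<^sub>R x - t\<^sup>2 *\<^sub>R u \<le> sq x" if "x \<in> principal_ideal u" "t \<in> \<rat>" for x t
    using sq that by simp
  have le: "sq x \<le> b" if "x \<in> principal_ideal u" "\<And>t. t \<in> \<rat> \<Longrightarrow> (2 * t) *\<^sub>R x - t\<^sup>2 *\<^sub>R u \<le> b" for x b
    using sq that by simp
  \<comment> \<open>The choice ensures \<open>t * f u < \<delta>\<close>; the summand 1 keeps the
    denominator positive.\<close>
  obtain t where t: "t \<in> \<rat>" "0 < t" "t < \<delta> / (f u + 1)"
    using Rats_dense_in_real[of 0 "\<delta> / (f u + 1)"] f(2)[OF u] f(3) by auto
  show thesis
  proof (rule that[of "t * \<delta>" "\<lambda>x. f (sq x)" "f (4 *\<^sub>R u)"])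
    show "0 < t * \<delta>" using t f by simp
    fix x y assume "x \<in> principal_ideal u" "y \<in> principal_ideal u"
    then have "sq (x + y) + sq (x - y) = 2 *\<^sub>R sq x + 2 *\<^sub>R sq y"
      by (rule square_parallelogram) (fact ge le)+
    from arg_cong[OF this, of f]
    show "f (sq (x + y)) + f (sq (x - y)) = 2 * f (sq x) + 2 * f (sq y)"
      by (simp add: f.add f.scaleR)
  next
    fix x assume x: "\<bar>x\<bar> \<le> 2 *\<^sub>R u"
    have V: "x \<in> principal_ideal u" using principal_idealI[OF x] by simp
    have "0 \<le> sq x" using ge[OF V, of 0] by simp
    then have "0 \<le> f (sq x)" by (rule f)
    moreover have "sq x \<le> 4 *\<^sub>R u" using le[OF V] scaleR_square_bound[OF u x] by simp
    then have "f (sq x) \<le> f (4 *\<^sub>R u)" by (rule fmono)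
    ultimately show "\<bar>f (sq x)\<bar> \<le> f (4 *\<^sub>R u)" by simp
    assume small: "f (sq x) < t * \<delta>"
    \<comment> \<open>The defining bound at \<open>t\<close> and \<open>- t\<close> controls the
      modulus of \<open>x\<close> by its square, up to an error of order \<open>t\<close> after
      division by \<open>2 * t\<close>.\<close>
    have "(2 * t) *\<^sub>R x \<le> sq x + t\<^sup>2 *\<^sub>R u" using ge[OF V t(1)] by (simp add: algebra_simps)
    moreover have "- ((2 * t) *\<^sub>R x) \<le> sq x + t\<^sup>2 *\<^sub>R u" using ge[OF V, of "- t"] t(1) by (simp add: algebra_simps)
    ultimately have "\<bar>(2 * t) *\<^sub>R x\<bar> \<le> sq x + t\<^sup>2 *\<^sub>R u" by (rule abs_leI)
    then have "f \<bar>(2 * t) *\<^sub>R x\<bar> \<le> f (sq x + t\<^sup>2 *\<^sub>R u)" by (rule fmono)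
    then have "2 * t * f \<bar>x\<bar> \<le> f (sq x) + t * (t * f u)"
      using t(2) by (simp add: abs_scaleR_lattice f.add f.scaleR power2_eq_square abs_mult)
    also have "\<dots> < t * \<delta> + t * \<delta>"
    proof -
      have "t * (f u + 1) < \<delta>" using t f(2)[OF u] by (simp add: field_simps)
      then have "t * f u < \<delta>" using t by (simp add: algebra_simps)
      then show ?thesis using small t by (intro add_strict_mono mult_strict_left_mono)
    qed
    finally have "f \<bar>x\<bar> < \<delta>" using t by simp
    then have "norm \<bar>x\<bar> \<le> e" using f(4)[of "\<bar>x\<bar>"] x by simp
    then show "norm x \<le> e" by simp
  qed
qed

subsection \<open>Cesaro means of almost order bounded sequences\<close>

definition polar :: "('a::real_vector \<Rightarrow> real) \<Rightarrow> 'a \<Rightarrow> 'a \<Rightarrow> real" where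
  "polar Q x y = (Q (x + y) - Q (x - y)) / 4"

locale parallelogram =
  fixes V :: "'a::real_vector set" and Q :: "'a \<Rightarrow> real"
  assumes V: "subspace V"
    and law: "\<And>x y. x \<in> V \<Longrightarrow> y \<in> V \<Longrightarrow> Q (x + y) + Q (x - y) = 2 * Q x + 2 * Q y"
begin

lemmas closure = subspace_0[OF V] subspace_add[OF V] subspace_diff[OF V] subspace_neg[OF V]
  subspace_scale[OF V] subspace_sum[OF V]

lemma zero: "Q 0 = 0"
  using law[of 0 0] closure by simp

lemma even: "x \<in> V \<Longrightarrow> Q (- x) = Q x"
  using law[of 0 x] closure zero by simp

lemma polar_commute: "x \<in> V \<Longrightarrow> y \<in> V \<Longrightarrow> polar Q x y = polar Q y x"
  using even[of "x - y"] closure by (simp add: polar_def add.commute)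

lemma polar_zero: "x \<in> V \<Longrightarrow> polar Q 0 x = 0"
  by (simp add: polar_def even)

lemma polar_self: "x \<in> V \<Longrightarrow> polar Q x x = Q x"
  using law[of x x] zero by (simp add: polar_def)

lemma Q_diff:
  assumes "x \<in> V" "y \<in> V"
  shows "Q (x - y) = polar Q x x - 2 * polar Q x y + polar Q y y"
  using law[OF assms] polar_self[OF assms(1)] polar_self[OF assms(2)] polar_def[of Q x y]
  by (simp add: field_simps)

text \<open>The Jordan-von Neumann argument: three instances of the law express
  \<open>Q (x + y + z)\<close> by values at sums of at most two vectors; subtracting the formula for
  \<open>- z\<close> leaves additivity.\<close>

lemma polar_add:
  assumes x: "x \<in> V" and y: "y \<in> V" and z: "z \<in> V"
  shows "polar Q (x + y) z = polar Q x z + polar Q y z"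
proof -
  have sum3: "Q (x + y + z) = Q (x + z) + Q (y + z) + Q x + Q y - Q (x - y) - Q z" if z: "z \<in> V" for z
  proof -
    have "Q ((x + z) + y) + Q ((x + z) - y) = 2 * Q (x + z) + 2 * Q y"
      "Q ((y + z) + x) + Q ((y + z) - x) = 2 * Q (y + z) + 2 * Q x"
      "Q ((x - y) + z) + Q ((x - y) - z) = 2 * Q (x - y) + 2 * Q z"
      using law[OF closure(2)[OF x z] y] law[OF closure(2)[OF y z] x] law[OF closure(3)[OF x y] z] .
    moreover have "Q ((y + z) - x) = Q ((x - y) - z)"
      using even[of "(x - y) - z"] x y z closure by (simp add: algebra_simps)
    moreover have "(x + z) + y = x + y + z" "(y + z) + x = x + y + z" "(x + z) - y = (x - y) + z"
      by simp_all
    ultimately show ?thesis by (simp only:)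
  qed
  have "Q (x + y - z) = Q (x - z) + Q (y - z) + Q x + Q y - Q (x - y) - Q z"
    using sum3[of "- z"] z even[OF z] closure(4) by simp
  with sum3[OF z] show ?thesis by (simp add: polar_def field_simps)
qed

lemma polar_sum:
  assumes "\<And>i. i \<in> A \<Longrightarrow> x i \<in> V" "z \<in> V"
  shows "polar Q (\<Sum>i\<in>A. x i) z = (\<Sum>i\<in>A. polar Q (x i) z)"
  using assms
  by (induct A rule: infinite_finite_induct) (simp_all add: polar_zero polar_add closure)

text \<open>The law supplies additivity rather than real homogeneity, so the one scalar occurring in
  Cesaro means is treated by adding \<open>n + 1\<close> copies.\<close>

lemma polar_divide:
  assumes x: "x \<in> V" and z: "z \<in> V"
  shows "polar Q ((1 / real (Suc n)) *\<^sub>R x) z = polar Q x z / real (Suc n)"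
proof -
  let ?y = "(1 / real (Suc n)) *\<^sub>R x"
  have "polar Q (\<Sum>i\<in>{..n}. ?y) z = (\<Sum>i\<in>{..n}. polar Q ?y z)"
    using x z by (intro polar_sum closure)
  moreover have "(\<Sum>i\<in>{..n}. ?y) = x"
    by (simp add: sum_constant_scaleR del: of_nat_Suc)
  ultimately show ?thesis by (simp add: field_simps del: of_nat_Suc)
qed

lemma cesaro_mean_in: "(\<And>k. w k \<in> V) \<Longrightarrow> cesaro_mean w n \<in> V"
  unfolding cesaro_mean_def by (intro closure)

lemma polar_cesaro_mean:
  assumes x: "\<And>k. x k \<in> V" and y: "\<And>k. y k \<in> V"
  shows "polar Q (cesaro_mean x n) (cesaro_mean y m) =
    (\<Sum>i\<le>n. \<Sum>j\<le>m. polar Q (x i) (y j)) / (real (Suc n) * real (Suc m))"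
proof -
  have left: "polar Q (cesaro_mean x n) z = (\<Sum>i\<le>n. polar Q (x i) z) / real (Suc n)"
    if "z \<in> V" "\<And>k. x k \<in> V" for z x n
    unfolding cesaro_mean_def using that
    by (subst polar_divide) (auto simp: polar_sum intro: closure simp del: of_nat_Suc)
  have "polar Q (cesaro_mean x n) (cesaro_mean y m) =
      (\<Sum>i\<le>n. polar Q (x i) (cesaro_mean y m)) / real (Suc n)"
    by (intro left cesaro_mean_in x y)
  also have "(\<Sum>i\<le>n. polar Q (x i) (cesaro_mean y m)) =
      (\<Sum>i\<le>n. (\<Sum>j\<le>m. polar Q (x i) (y j)) / real (Suc m))"
  proof (intro sum.cong refl)
    fix i
    have "polar Q (x i) (cesaro_mean y m) = polar Q (cesaro_mean y m) (x i)"
      by (intro polar_commute cesaro_mean_in x y)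
    also have "\<dots> = (\<Sum>j\<le>m. polar Q (y j) (x i)) / real (Suc m)" by (intro left x y)
    also have "(\<Sum>j\<le>m. polar Q (y j) (x i)) = (\<Sum>j\<le>m. polar Q (x i) (y j))"
      by (intro sum.cong refl polar_commute x y)
    finally show "polar Q (x i) (cesaro_mean y m) = (\<Sum>j\<le>m. polar Q (x i) (y j)) / real (Suc m)" .
  qed
  finally show ?thesis by (simp add: sum_divide_distrib[symmetric] field_simps del: of_nat_Suc)
qed

end

text \<open>Entries are near \<open>c\<close> outside the first \<open>N\<close> rows and columns
  and the positions with \<open>s i = s' j\<close>, of which each row has at most one. These
  exceptions number on the order of \<open>n + m\<close> and vanish in a mean over
  \<open>n * m\<close> entries.\<close>

lemma double_mean_offdiagonal:
  fixes a :: "nat \<Rightarrow> nat \<Rightarrow> real"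
  assumes bd: "\<And>p q. \<bar>a p q\<bar> \<le> M"
    and off: "\<And>\<epsilon>. 0 < \<epsilon> \<Longrightarrow> \<exists>N. \<forall>p\<ge>N. \<forall>q\<ge>N. p \<noteq> q \<longrightarrow> \<bar>a p q - c\<bar> \<le> \<epsilon>"
    and s: "strict_mono s" and s': "strict_mono s'" and e: "0 < \<epsilon>"
  shows "\<exists>K. \<forall>n\<ge>K. \<forall>m\<ge>K.
    \<bar>(\<Sum>i\<le>n. \<Sum>j\<le>m. a (s i) (s' j)) / (real (Suc n) * real (Suc m)) - c\<bar> \<le> \<epsilon>"
proof -
  obtain N where N: "\<And>p q. N \<le> p \<Longrightarrow> N \<le> q \<Longrightarrow> p \<noteq> q \<Longrightarrow> \<bar>a p q - c\<bar> \<le> \<epsilon> / 2"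
    using off[of "\<epsilon> / 2"] e by auto
  define D where "D = M + \<bar>c\<bar>"
  have D0: "0 \<le> D" using bd[of 0 0] by (simp add: D_def)
  have aD: "\<bar>a p q - c\<bar> \<le> D" for p q using bd[of p q] by (simp add: D_def)
  let ?I = "\<lambda>P. if P then 1 else (0::real)"
  have pt: "\<bar>a (s i) (s' j) - c\<bar> \<le> \<epsilon> / 2 + D * ?I (i < N) + D * ?I (j < N) + D * ?I (s i = s' j)" for i j
  proof (cases "i < N \<or> j < N \<or> s i = s' j")
    case True
    have "D \<le> D * ?I (i < N) + D * ?I (j < N) + D * ?I (s i = s' j)" using True D0 by auto
    then show ?thesis using aD[of "s i" "s' j"] e by linarith
  next
    case False
    then have "N \<le> s i" "N \<le> s' j"
      using strict_mono_imp_increasing[OF s, of i] strict_mono_imp_increasing[OF s', of j] by auto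
    then show ?thesis using N[of "s i" "s' j"] False by simp
  qed
  have cnt: "(\<Sum>i\<le>n. ?I (i < N)) \<le> real N" for n :: nat
  proof -
    have "(\<Sum>i\<le>n. ?I (i < N)) = real (card ({..n} \<inter> {i. i < N}))" by (simp add: sum.If_cases)
    also have "\<dots> \<le> real (card {..<N})" by (intro of_nat_mono card_mono) auto
    finally show ?thesis by simp
  qed
  have diag: "(\<Sum>j\<le>m. ?I (s i = s' j)) \<le> 1" for i m
  proof -
    have "(\<Sum>j\<le>m. ?I (s i = s' j)) = real (card ({..m} \<inter> {j. s i = s' j}))" by (simp add: sum.If_cases)
    also have "card ({..m} \<inter> {j. s i = s' j}) \<le> 1"
    proof (rule card_le_Suc0_iff_eq[THEN iffD2, folded One_nat_def])
      show "\<forall>j\<in>{..m} \<inter> {j. s i = s' j}. \<forall>k\<in>{..m} \<inter> {j. s i = s' j}. j = k"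
        using strict_mono_eq[OF s'] by auto
    qed simp
    finally show ?thesis by simp
  qed
  \<comment> \<open>This size makes the total exceptional contribution at most half of
    \<open>\<epsilon>\<close> times the number of entries.\<close>
  obtain K where K: "2 * D * (2 * real N + 2) / \<epsilon> \<le> real K" using real_arch_simple by blast
  have "\<bar>(\<Sum>i\<le>n. \<Sum>j\<le>m. a (s i) (s' j)) / (real (Suc n) * real (Suc m)) - c\<bar> \<le> \<epsilon>"
    if nm: "K \<le> n" "K \<le> m" for n m
  proof -
    define X Y where "X = real (Suc n)" and "Y = real (Suc m)"
    have XY: "0 < X" "0 < Y" by (auto simp: X_def Y_def)
    have KX: "2 * D * (2 * real N + 2) \<le> \<epsilon> * X" "2 * D * (2 * real N + 2) \<le> \<epsilon> * Y"
    proof -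
      have "2 * D * (2 * real N + 2) \<le> \<epsilon> * real K" using K e by (simp add: field_simps)
      moreover have "\<epsilon> * real K \<le> \<epsilon> * X" "\<epsilon> * real K \<le> \<epsilon> * Y"
        using nm e by (auto simp: X_def Y_def)
      ultimately show "2 * D * (2 * real N + 2) \<le> \<epsilon> * X" "2 * D * (2 * real N + 2) \<le> \<epsilon> * Y" by auto
    qed
    have "(\<Sum>i\<le>n. \<Sum>j\<le>m. a (s i) (s' j)) - X * Y * c = (\<Sum>i\<le>n. \<Sum>j\<le>m. a (s i) (s' j) - c)"
      by (simp add: sum_subtractf X_def Y_def)
    then have "\<bar>(\<Sum>i\<le>n. \<Sum>j\<le>m. a (s i) (s' j)) - X * Y * c\<bar> \<le> (\<Sum>i\<le>n. \<Sum>j\<le>m. \<bar>a (s i) (s' j) - c\<bar>)"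
      by (auto intro!: order_trans[OF sum_abs] sum_mono)
    also have "\<dots> \<le> (\<Sum>i\<le>n. \<Sum>j\<le>m. \<epsilon> / 2 + D * ?I (i < N) + D * ?I (j < N) + D * ?I (s i = s' j))"
      by (intro sum_mono pt)
    also have "\<dots> = X * Y * (\<epsilon> / 2) + D * (Y * (\<Sum>i\<le>n. ?I (i < N))) + D * (X * (\<Sum>j\<le>m. ?I (j < N)))
        + D * (\<Sum>i\<le>n. \<Sum>j\<le>m. ?I (s i = s' j))"
      unfolding sum.distrib sum_distrib_left[symmetric] sum_constant card_atMost X_def Y_def by (simp add: mult_ac)
    also have "\<dots> \<le> X * Y * (\<epsilon> / 2) + D * (Y * real N) + D * (X * real N) + D * X"
    proof (intro add_mono mult_left_mono cnt order_refl)
      have "(\<Sum>i\<le>n. \<Sum>j\<le>m. ?I (s i = s' j)) \<le> (\<Sum>i\<le>n. 1)" by (intro sum_mono diag)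
      then show "(\<Sum>i\<le>n. \<Sum>j\<le>m. ?I (s i = s' j)) \<le> X" by (simp add: X_def)
    qed (use D0 XY in auto)
    also have "\<dots> \<le> X * Y * (\<epsilon> / 2) + X * Y * (\<epsilon> / 2)"
    proof -
      have "4 * (D * (X * real N)) + 4 * (D * X) \<le> \<epsilon> * (X * Y)"
        using mult_left_mono[OF KX(2), of X] XY by (simp add: algebra_simps)
      moreover have "4 * (D * (Y * real N)) + 4 * (D * Y) \<le> \<epsilon> * (X * Y)"
        using mult_left_mono[OF KX(1), of Y] XY by (simp add: algebra_simps)
      moreover have "0 \<le> D * Y" using D0 XY by simp
      ultimately show ?thesis by (simp add: algebra_simps)
    qed
    finally have "\<bar>(\<Sum>i\<le>n. \<Sum>j\<le>m. a (s i) (s' j)) - X * Y * c\<bar> \<le> X * Y * \<epsilon>" by simp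
    moreover have "(\<Sum>i\<le>n. \<Sum>j\<le>m. a (s i) (s' j)) / (X * Y) - c =
        ((\<Sum>i\<le>n. \<Sum>j\<le>m. a (s i) (s' j)) - X * Y * c) / (X * Y)" using XY by (simp add: field_simps)
    ultimately have "\<bar>(\<Sum>i\<le>n. \<Sum>j\<le>m. a (s i) (s' j)) / (X * Y) - c\<bar> \<le> X * Y * \<epsilon> / (X * Y)"
      using XY by (simp add: abs_divide abs_mult pos_divide_le_eq mult_ac)
    then show ?thesis using XY by (simp add: X_def Y_def del: of_nat_Suc)
  qed
  then show ?thesis by blast
qed

text \<open>One subsequence serves all matrices \<open>a m\<close>. First the limits in the row
  index are made to exist, then the limit of these limits, and finally the indices are spread so
  that an entry below the diagonal is close to its row-index limit. Symmetry covers the entries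
  above the diagonal.\<close>

lemma offdiagonal_limit_subsequence:
  fixes a :: "nat \<Rightarrow> nat \<Rightarrow> nat \<Rightarrow> real"
  assumes bd: "\<And>m p q. \<bar>a m p q\<bar> \<le> M m" and sym: "\<And>m p q. a m p q = a m q p"
  shows "\<exists>r. strict_mono (r :: nat \<Rightarrow> nat) \<and>
    (\<forall>m. \<exists>c. \<forall>\<epsilon>>0. \<exists>N. \<forall>p\<ge>N. \<forall>q\<ge>N. p \<noteq> q \<longrightarrow> \<bar>a m (r p) (r q) - c\<bar> \<le> \<epsilon>)"
proof -
  \<comment> \<open>Scaling gives a bound independent of \<open>m\<close>, as diagonal extraction
    over the countably many pairs \<open>(m, q)\<close> requires.\<close>
  define b where "b m p q = a m p q / (M m + 1)" for m p q
  have M0: "0 \<le> M m" for m using bd[of m 0 0] by simp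
  have b1: "norm (b m p q) \<le> 1" for m p q
    using bd[of m p q] M0[of m] by (simp add: b_def field_simps)
  obtain k1 where k1: "strict_mono (k1 :: nat \<Rightarrow> nat)"
    "\<And>x. x \<in> UNIV \<Longrightarrow> \<exists>l. (\<lambda>n. (\<lambda>n (m, q). b m n q) (k1 n) x) \<longlonglongrightarrow> l"
    by (rule function_convergent_subsequence[of UNIV "\<lambda>n (m, q). b m n q" 1]) (use b1 in auto)
  have "\<forall>m q. \<exists>l. (\<lambda>n. b m (k1 n) q) \<longlonglongrightarrow> l" using k1(2) by (force split: prod.splits)
  then obtain L where L: "\<And>m q. (\<lambda>n. b m (k1 n) q) \<longlonglongrightarrow> L m q" by metis
  have L1: "norm (L m q) \<le> 1" for m q
    by (rule LIMSEQ_le_const2[OF tendsto_norm[OF L]]) (use b1 in auto)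
  obtain k2 where k2: "strict_mono (k2 :: nat \<Rightarrow> nat)"
    "\<And>m. m \<in> UNIV \<Longrightarrow> \<exists>l. (\<lambda>n. L m (k1 (k2 n))) \<longlonglongrightarrow> l"
    by (rule function_convergent_subsequence[of UNIV "\<lambda>n m. L m (k1 n)" 1]) (use L1 in auto)
  then obtain c where c: "\<And>m. (\<lambda>n. L m (k1 (k2 n))) \<longlonglongrightarrow> c m" by (metis UNIV_I)
  define k where "k n = k1 (k2 n)" for n
  have k: "strict_mono k" using k1(1) k2(1) by (simp add: k_def strict_mono_def)
  have Lk: "(\<lambda>n. b m (k n) q) \<longlonglongrightarrow> L m q" for m q
    using LIMSEQ_subseq_LIMSEQ[OF L k2(1), of m q] by (simp add: k_def o_def)
  have ck: "(\<lambda>n. L m (k n)) \<longlonglongrightarrow> c m" for m using c by (simp add: k_def)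
  \<comment> \<open>Each new index exceeds the thresholds of all earlier columns and of the first
    \<open>n + 1\<close> matrices, with error \<open>inverse (real (Suc n))\<close>.\<close>
  have "\<exists>t. \<forall>n. True \<and> (t n < t (Suc n) \<and>
      (\<forall>m\<le>n. \<forall>j\<le>t n. \<forall>i\<ge>t (Suc n). \<bar>b m (k i) (k j) - L m (k j)\<bar> \<le> inverse (real (Suc n))))"
  proof (rule dependent_nat_choice)
    fix x n :: nat
    have "eventually (\<lambda>i. \<bar>b m (k i) (k j) - L m (k j)\<bar> \<le> inverse (real (Suc n))) sequentially" for m j
    proof -
      have "eventually (\<lambda>i. dist (b m (k i) (k j)) (L m (k j)) < inverse (real (Suc n))) sequentially"
        by (intro tendstoD[OF Lk]) simp
      then show ?thesis by eventually_elim (simp add: dist_real_def)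
    qed
    then have "eventually (\<lambda>i. \<forall>m\<in>{..n}. \<forall>j\<in>{..x}. \<bar>b m (k i) (k j) - L m (k j)\<bar> \<le> inverse (real (Suc n))) sequentially"
      by (intro eventually_ball_finite finite_atMost ballI)
    then obtain N where N: "\<And>i m j. N \<le> i \<Longrightarrow> m \<le> n \<Longrightarrow> j \<le> x \<Longrightarrow>
        \<bar>b m (k i) (k j) - L m (k j)\<bar> \<le> inverse (real (Suc n))"
      by (auto simp: eventually_sequentially)
    show "\<exists>y. True \<and> (x < y \<and> (\<forall>m\<le>n. \<forall>j\<le>x. \<forall>i\<ge>y. \<bar>b m (k i) (k j) - L m (k j)\<bar> \<le> inverse (real (Suc n))))"
      by (intro exI[of _ "max N (Suc x)"]) (use N in auto)
  qed simp
  then obtain t where t: "\<And>n. t n < t (Suc n)"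
    "\<And>n m j i. m \<le> n \<Longrightarrow> j \<le> t n \<Longrightarrow> t (Suc n) \<le> i \<Longrightarrow> \<bar>b m (k i) (k j) - L m (k j)\<bar> \<le> inverse (real (Suc n))"
    by blast
  have tm: "strict_mono t" using t(1) by (simp add: strict_mono_Suc_iff)
  define r where "r n = k (t n)" for n
  have "strict_mono r" using k tm by (simp add: r_def strict_mono_def)
  moreover have "\<exists>N. \<forall>p\<ge>N. \<forall>q\<ge>N. p \<noteq> q \<longrightarrow> \<bar>a m (r p) (r q) - c m * (M m + 1)\<bar> \<le> \<epsilon>" if e: "0 < \<epsilon>" for m \<epsilon>
  proof -
    define d where "d = \<epsilon> / (M m + 1)"
    have d: "0 < d" using e M0[of m] by (simp add: d_def)
    have "(\<lambda>n. L m (r n)) \<longlonglongrightarrow> c m" using LIMSEQ_subseq_LIMSEQ[OF ck tm, of m] by (simp add: r_def o_def)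
    then have "eventually (\<lambda>q. \<bar>L m (r q) - c m\<bar> < d / 2) sequentially"
      using tendstoD[of _ "c m" sequentially "d / 2"] d by (simp add: dist_real_def)
    moreover have "eventually (\<lambda>q. inverse (real (Suc q)) < d / 2) sequentially"
      using d LIMSEQ_inverse_real_of_nat by (intro order_tendstoD(2)) auto
    ultimately have "eventually (\<lambda>q. \<bar>L m (r q) - c m\<bar> < d / 2 \<and> inverse (real (Suc q)) < d / 2) sequentially"
      by (rule eventually_conj)
    then obtain N where N: "\<And>q. N \<le> q \<Longrightarrow> \<bar>L m (r q) - c m\<bar> < d / 2 \<and> inverse (real (Suc q)) < d / 2"
      unfolding eventually_sequentially by blast
    have less: "\<bar>a m (r p) (r q) - c m * (M m + 1)\<bar> \<le> \<epsilon>" if "max N m \<le> q" "q < p" for p q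
    proof -
      have "\<bar>b m (r p) (r q) - L m (r q)\<bar> \<le> inverse (real (Suc q))"
        unfolding r_def using that strict_mono_leD[OF tm, of "Suc q" p] by (intro t(2)) auto
      moreover have "\<bar>L m (r q) - c m\<bar> < d / 2" "inverse (real (Suc q)) < d / 2" using N[of q] that by simp_all
      ultimately have "\<bar>b m (r p) (r q) - c m\<bar> \<le> d" by linarith
      then have "\<bar>b m (r p) (r q) - c m\<bar> * (M m + 1) \<le> \<epsilon>"
        using M0[of m] by (simp add: d_def field_simps)
      moreover have "a m (r p) (r q) - c m * (M m + 1) = (b m (r p) (r q) - c m) * (M m + 1)"
        using M0[of m] by (simp add: b_def field_simps)
      ultimately show ?thesis using M0[of m] by (simp add: abs_mult)
    qed
    have "\<bar>a m (r p) (r q) - c m * (M m + 1)\<bar> \<le> \<epsilon>" if "max N m \<le> p" "max N m \<le> q" "p \<noteq> q" for p q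
      using less[of q p] less[of p q] that sym[of m "r p" "r q"] by (cases "q < p") auto
    then show ?thesis by blast
  qed
  ultimately show ?thesis by blast
qed

section \<open>Cesaro means\<close>

lemma cesaro_mean_linear: "linear f \<Longrightarrow> f (cesaro_mean w n) = cesaro_mean (\<lambda>k. f (w k)) n"
  by (simp add: cesaro_mean_def linear_scale linear_sum)

lemma cesaro_mean_add: "cesaro_mean (\<lambda>k. v k + w k) n = cesaro_mean v n + cesaro_mean w n"
  by (simp add: cesaro_mean_def sum.distrib scaleR_add_right)

lemma cesaro_mean_diff: "cesaro_mean (\<lambda>k. v k - w k) n = cesaro_mean v n - cesaro_mean w n"
  by (simp add: cesaro_mean_def sum_subtractf scaleR_diff_right)

lemma cesaro_mean_const: "cesaro_mean (\<lambda>k. c) n = (c :: 'a::real_vector)"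
  by (simp add: cesaro_mean_def sum_constant_scaleR del: of_nat_Suc)

lemma cesaro_mean_norm: "norm (cesaro_mean w n) \<le> cesaro_mean (\<lambda>k. norm (w k)) n"
  by (auto simp: cesaro_mean_def intro!: divide_right_mono norm_sum)

lemma cesaro_mean_mono:
  fixes v :: "nat \<Rightarrow> 'a::ordered_real_vector"
  shows "(\<And>k. v k \<le> w k) \<Longrightarrow> cesaro_mean v n \<le> cesaro_mean w n"
  by (auto simp: cesaro_mean_def intro!: scaleR_left_mono sum_mono)

lemma cesaro_mean_abs:
  fixes w :: "nat \<Rightarrow> 'a::banach_lattice"
  shows "\<bar>cesaro_mean w n\<bar> \<le> cesaro_mean (\<lambda>k. \<bar>w k\<bar>) n"
  by (auto simp: cesaro_mean_def abs_scaleR_lattice intro!: scaleR_left_mono abs_sum_le_lattice)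

lemma almost_order_bounded_approx:
  assumes "almost_order_bounded (range (y :: nat \<Rightarrow> 'a::banach_lattice))" "0 < e"
  shows "\<exists>u\<ge>0. \<exists>v. \<forall>k. \<bar>v k\<bar> \<le> u \<and> norm (y k - v k) \<le> e"
proof -
  obtain u where u: "0 \<le> u" "range y \<subseteq> {v + e *\<^sub>R b | v b. v \<in> {-u..u} \<and> b \<in> cball 0 1}"
    using assms unfolding almost_order_bounded_def by blast
  have "\<exists>v. \<bar>v\<bar> \<le> u \<and> norm (y k - v) \<le> e" for k
  proof -
    have "y k \<in> {v + e *\<^sub>R b | v b. v \<in> {-u..u} \<and> b \<in> cball 0 1}" using u(2) by blast
    then obtain v b where vb: "y k = v + e *\<^sub>R b" "v \<in> {-u..u}" "norm b \<le> 1" by auto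
    have "\<bar>v\<bar> \<le> u" using vb(2) by (intro abs_leI) (auto simp: minus_le_iff)
    moreover have "norm (y k - v) \<le> e" using vb(1,3) assms(2) by (simp add: mult_left_le)
    ultimately show ?thesis by blast
  qed
  then show ?thesis using u(1) by metis
qed

text \<open>For each \<open>m\<close> the sequence is replaced, up to \<open>?e m\<close>, by one in
  an order interval with its own quadratic form, and one subsequence \<open>r\<close> handles all
  Gram matrices. Means along two further subsequences are compared at once: equal ones give the
  Cauchy property, different ones a common limit.\<close>

lemma almost_order_bounded_cesaro:
  fixes y :: "nat \<Rightarrow> 'a::banach_lattice"
  assumes oc: "order_continuous TYPE('a)" and aob: "almost_order_bounded (range y)"
  shows "\<exists>r w. strict_mono (r :: nat \<Rightarrow> nat) \<and> (\<forall>s. strict_mono s \<longrightarrow> cesaro_mean (\<lambda>k. y (r (s k))) \<longlonglongrightarrow> w)"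
proof -
  let ?e = "\<lambda>m. inverse (real (Suc m))"
  have "\<forall>m. \<exists>u\<ge>0. \<exists>v. \<forall>k. \<bar>v k\<bar> \<le> u \<and> norm (y k - v k) \<le> ?e m"
    by (intro allI almost_order_bounded_approx[OF aob]) simp
  then obtain u v where u: "\<And>m. 0 \<le> u m" and v: "\<And>m k. \<bar>v m k\<bar> \<le> u m"
    and yv: "\<And>m k. norm (y k - v m k) \<le> ?e m" by metis
  have "\<forall>m. \<exists>(Q :: 'a \<Rightarrow> real) \<eta> M. 0 < \<eta> \<and>
    (\<forall>x\<in>principal_ideal (u m). \<forall>y\<in>principal_ideal (u m). Q (x + y) + Q (x - y) = 2 * Q x + 2 * Q y) \<and>
    (\<forall>x. \<bar>x\<bar> \<le> 2 *\<^sub>R u m \<longrightarrow> \<bar>Q x\<bar> \<le> M) \<and>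
    (\<forall>x. \<bar>x\<bar> \<le> 2 *\<^sub>R u m \<longrightarrow> Q x < \<eta> \<longrightarrow> norm x \<le> ?e m)"
  proof
    fix m
    show "\<exists>(Q :: 'a \<Rightarrow> real) \<eta> M. 0 < \<eta> \<and>
      (\<forall>x\<in>principal_ideal (u m). \<forall>y\<in>principal_ideal (u m). Q (x + y) + Q (x - y) = 2 * Q x + 2 * Q y) \<and>
      (\<forall>x. \<bar>x\<bar> \<le> 2 *\<^sub>R u m \<longrightarrow> \<bar>Q x\<bar> \<le> M) \<and>
      (\<forall>x. \<bar>x\<bar> \<le> 2 *\<^sub>R u m \<longrightarrow> Q x < \<eta> \<longrightarrow> norm x \<le> ?e m)"
      by (rule order_continuous_quadratic_form[OF oc u[of m], of "?e m"]) (simp, blast)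
  qed
  then obtain Q :: "nat \<Rightarrow> 'a \<Rightarrow> real" and \<eta> M where *: "\<forall>m. 0 < \<eta> m \<and>
    (\<forall>x\<in>principal_ideal (u m). \<forall>y\<in>principal_ideal (u m). Q m (x + y) + Q m (x - y) = 2 * Q m x + 2 * Q m y) \<and>
    (\<forall>x. \<bar>x\<bar> \<le> 2 *\<^sub>R u m \<longrightarrow> \<bar>Q m x\<bar> \<le> M m) \<and>
    (\<forall>x. \<bar>x\<bar> \<le> 2 *\<^sub>R u m \<longrightarrow> Q m x < \<eta> m \<longrightarrow> norm x \<le> ?e m)"
    unfolding choice_iff by (elim exE) (rule that)
  have \<eta>: "0 < \<eta> m"
    and law: "\<forall>x\<in>principal_ideal (u m). \<forall>y\<in>principal_ideal (u m).
        Q m (x + y) + Q m (x - y) = 2 * Q m x + 2 * Q m y"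
    and QM: "\<bar>x\<bar> \<le> 2 *\<^sub>R u m \<Longrightarrow> \<bar>Q m x\<bar> \<le> M m"
    and Qsmall: "\<bar>x\<bar> \<le> 2 *\<^sub>R u m \<Longrightarrow> Q m x < \<eta> m \<Longrightarrow> norm x \<le> ?e m" for m x
    using *[rule_format, of m] by blast+
  have par: "parallelogram (principal_ideal (u m)) (Q m)" for m
    using law[of m] by unfold_locales (auto simp: subspace_principal_ideal)
  have vV: "v m k \<in> principal_ideal (u m)" for m k
    using v[of m k] by (intro principal_idealI[of _ 1]) auto
  have twice: "\<bar>x + y\<bar> \<le> 2 *\<^sub>R u m" "\<bar>x - y\<bar> \<le> 2 *\<^sub>R u m" if "\<bar>x\<bar> \<le> u m" "\<bar>y\<bar> \<le> u m" for x y m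
    using order_trans[OF abs_triangle_ineq add_mono[OF that]]
      order_trans[OF abs_triangle_ineq4 add_mono[OF that]] by (auto simp: scaleR_2)
  define a where "a m p q = polar (Q m) (v m p) (v m q)" for m p q
  have a_bound: "\<bar>a m p q\<bar> \<le> M m" for m p q
  proof -
    have "\<bar>Q m (v m p + v m q)\<bar> \<le> M m" "\<bar>Q m (v m p - v m q)\<bar> \<le> M m"
      by (intro QM twice v)+
    then show ?thesis by (simp add: a_def polar_def)
  qed
  have a_sym: "a m p q = a m q p" for m p q
    unfolding a_def by (rule parallelogram.polar_commute[OF par vV vV])
  from offdiagonal_limit_subsequence[of a M, OF a_bound a_sym] obtain r where r: "strict_mono (r :: nat \<Rightarrow> nat)"
    and "\<forall>m. \<exists>c. \<forall>\<epsilon>>0. \<exists>N. \<forall>p\<ge>N. \<forall>q\<ge>N. p \<noteq> q \<longrightarrow> \<bar>a m (r p) (r q) - c\<bar> \<le> \<epsilon>"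
    by (elim exE conjE) (rule that)
  from choice[OF this(2)] obtain c where
    off': "\<forall>m. \<forall>\<epsilon>>0. \<exists>N. \<forall>p\<ge>N. \<forall>q\<ge>N. p \<noteq> q \<longrightarrow> \<bar>a m (r p) (r q) - c m\<bar> \<le> \<epsilon>"
    by (elim exE) (rule that)
  have off: "\<exists>N. \<forall>p\<ge>N. \<forall>q\<ge>N. p \<noteq> q \<longrightarrow> \<bar>a m (r p) (r q) - c m\<bar> \<le> \<epsilon>" if "0 < \<epsilon>" for m \<epsilon>
    using off' that by blast
  have main: "\<exists>K. \<forall>n\<ge>K. \<forall>n'\<ge>K.
      norm (cesaro_mean (\<lambda>k. y (r (s k))) n - cesaro_mean (\<lambda>k. y (r (s' k))) n') \<le> 3 * ?e m"
    if s: "strict_mono s" and s': "strict_mono s'" for s s' m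
  proof -
    interpret parallelogram "principal_ideal (u m)" "Q m" by (rule par)
    let ?D = "\<lambda>s s' n n'. (\<Sum>i\<le>n. \<Sum>j\<le>n'. a m (r (s i)) (r (s' j))) / (real (Suc n) * real (Suc n'))"
    \<comment> \<open>The form of a difference of means combines three double means with weights 1,
      -2 and 1. The limit \<open>c m\<close> cancels and the errors add up to
      \<open>4 * \<eta> m / 5\<close>.\<close>
    have D: "\<exists>K. \<forall>n\<ge>K. \<forall>n'\<ge>K. \<bar>?D s s' n n' - c m\<bar> \<le> \<eta> m / 5" if "strict_mono s" "strict_mono s'" for s s'
      by (rule double_mean_offdiagonal[of "\<lambda>p q. a m (r p) (r q)" "M m", OF a_bound off that])
        (use \<eta>[of m] in auto)
    from D[OF s s] D[OF s s'] D[OF s' s'] obtain K1 K2 K3 where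
      K: "\<forall>n\<ge>K1. \<forall>n'\<ge>K1. \<bar>?D s s n n' - c m\<bar> \<le> \<eta> m / 5"
      "\<forall>n\<ge>K2. \<forall>n'\<ge>K2. \<bar>?D s s' n n' - c m\<bar> \<le> \<eta> m / 5"
      "\<forall>n\<ge>K3. \<forall>n'\<ge>K3. \<bar>?D s' s' n n' - c m\<bar> \<le> \<eta> m / 5" by blast
    have "norm (cesaro_mean (\<lambda>k. y (r (s k))) n - cesaro_mean (\<lambda>k. y (r (s' k))) n') \<le> 3 * ?e m"
      if n: "max K1 (max K2 K3) \<le> n" "max K1 (max K2 K3) \<le> n'" for n n'
    proof -
      let ?v = "\<lambda>s. cesaro_mean (\<lambda>k. v m (r (s k)))" and ?y = "\<lambda>s. cesaro_mean (\<lambda>k. y (r (s k)))"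
      have vu: "\<bar>?v s n\<bar> \<le> u m" for s n
        using order_trans[OF cesaro_mean_abs cesaro_mean_mono, of "\<lambda>k. v m (r (s k))" "\<lambda>k. u m" n] v
        by (simp add: cesaro_mean_const)
      have pol: "polar (Q m) (?v s n) (?v s' n') = ?D s s' n n'" for s s' n n'
        unfolding a_def by (rule polar_cesaro_mean) (rule vV)+
      have "Q m (?v s n - ?v s' n') = ?D s s n n - 2 * ?D s s' n n' + ?D s' s' n' n'"
        unfolding pol[symmetric] by (intro Q_diff cesaro_mean_in vV)
      also have "\<dots> < \<eta> m"
      proof -
        have "\<bar>?D s s n n - c m\<bar> \<le> \<eta> m / 5" "\<bar>?D s s' n n' - c m\<bar> \<le> \<eta> m / 5" "\<bar>?D s' s' n' n' - c m\<bar> \<le> \<eta> m / 5"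
          using K n by (simp_all del: of_nat_Suc)
        then show ?thesis using \<eta>[of m] by linarith
      qed
      finally have "norm (?v s n - ?v s' n') \<le> ?e m" by (intro Qsmall twice vu)
      moreover have "norm (?y s n - ?v s n) \<le> ?e m" for s n
        using order_trans[OF cesaro_mean_norm cesaro_mean_mono, of "\<lambda>k. y (r (s k)) - v m (r (s k))" "\<lambda>_. ?e m" n] yv
        by (simp add: cesaro_mean_const cesaro_mean_diff del: of_nat_Suc)
      moreover have "norm (?y s n - ?y s' n') \<le> norm (?y s n - ?v s n) + norm (?v s n - ?v s' n') + norm (?y s' n' - ?v s' n')"
        using norm_triangle_ineq[of "?y s n - ?v s n" "?v s n - ?v s' n'"]
          norm_triangle_ineq4[of "(?y s n - ?v s n) + (?v s n - ?v s' n')" "?y s' n' - ?v s' n'"] by simp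
      ultimately have "norm (?y s n - ?y s' n') \<le> ?e m + ?e m + ?e m" by (meson add_mono order_trans)
      then show ?thesis by simp
    qed
    then show ?thesis by blast
  qed
  have small: "\<exists>K. \<forall>n\<ge>K. \<forall>n'\<ge>K.
      norm (cesaro_mean (\<lambda>k. y (r (s k))) n - cesaro_mean (\<lambda>k. y (r (s' k))) n') < \<epsilon>"
    if s: "strict_mono s" "strict_mono s'" and e: "0 < \<epsilon>" for s s' \<epsilon>
  proof -
    obtain m where "?e m < \<epsilon> / 3" using reals_Archimedean[of "\<epsilon> / 3"] e by auto
    then have "3 * ?e m < \<epsilon>" by simp
    then show ?thesis using main[OF s, of m] by (meson order_le_less_trans)
  qed
  have "Cauchy (cesaro_mean (\<lambda>k. y (r k)))"
    using small[of id id] by (intro CauchyI) (simp add: strict_mono_id)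
  then obtain w where w: "cesaro_mean (\<lambda>k. y (r k)) \<longlonglongrightarrow> w"
    by (auto simp: Cauchy_convergent_iff convergent_def)
  have "cesaro_mean (\<lambda>k. y (r (s k))) \<longlonglongrightarrow> w" if s: "strict_mono s" for s
  proof -
    have "(\<lambda>n. cesaro_mean (\<lambda>k. y (r (s k))) n - cesaro_mean (\<lambda>k. y (r k)) n) \<longlonglongrightarrow> 0"
      using small[OF s strict_mono_id] by (intro LIMSEQ_I) fastforce
    from tendsto_add[OF this w] show ?thesis by simp
  qed
  with r show ?thesis by blast
qed

subsection \<open>The disjoint part and domination\<close>

lemma cesaro_mean_null:
  fixes x :: "nat \<Rightarrow> real"
  assumes x: "x \<longlonglongrightarrow> 0"
  shows "cesaro_mean x \<longlonglongrightarrow> 0"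
proof (rule LIMSEQ_I)
  fix e :: real assume e: "0 < e"
  obtain N where N: "\<And>k. N \<le> k \<Longrightarrow> \<bar>x k\<bar> < e / 2"
    using LIMSEQ_D[OF x, of "e / 2"] e by auto
  define D where "D = (\<Sum>k<N. \<bar>x k\<bar>)"
  have D0: "0 \<le> D" by (simp add: D_def sum_nonneg)
  obtain K where K: "2 * D / e < real K" using reals_Archimedean2 by blast
  have "\<bar>cesaro_mean x n\<bar> < e" if n: "K \<le> n" for n
  proof -
    have "\<bar>\<Sum>k\<le>n. x k\<bar> \<le> (\<Sum>k\<le>n. \<bar>x k\<bar>)" by (rule sum_abs)
    also have "\<dots> \<le> (\<Sum>k\<le>n. e / 2 + (if k < N then \<bar>x k\<bar> else 0))"
      using N e by (intro sum_mono) (auto simp: not_less intro: less_imp_le)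
    also have "\<dots> = real (Suc n) * (e / 2) + (\<Sum>k\<in>{..n} \<inter> {k. k < N}. \<bar>x k\<bar>)"
      by (simp add: sum.distrib sum.If_cases)
    also have "(\<Sum>k\<in>{..n} \<inter> {k. k < N}. \<bar>x k\<bar>) \<le> D"
      unfolding D_def by (intro sum_mono2) auto
    also have "D < real (Suc n) * (e / 2)"
    proof -
      have "2 * D < real K * e" using K e by (simp add: pos_divide_less_eq)
      also have "\<dots> \<le> real (Suc n) * e" using n e by (intro mult_right_mono) auto
      finally show ?thesis by simp
    qed
    finally have "\<bar>\<Sum>k\<le>n. x k\<bar> < real (Suc n) * e" by (simp add: mult.commute)
    then have "\<bar>\<Sum>k\<le>n. x k\<bar> / real (Suc n) < e"
      by (subst pos_divide_less_eq) (simp_all add: mult.commute del: of_nat_Suc)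
    then show ?thesis by (simp add: cesaro_mean_def abs_divide)
  qed
  then show "\<exists>K. \<forall>n\<ge>K. norm (cesaro_mean x n - 0) < e" by auto
qed

text \<open>If \<open>f \<bar>z\<^sub>k\<bar>\<close> stayed away from zero, Hahn--Banach would give a functional taking the values
  \<open>\<delta>, -\<delta>, \<delta>, \<dots>\<close> along a subsequence of the disjoint sequence \<open>z\<close>. As \<open>y + z\<close> is weakly
  null, it would take on \<open>w\<close> both values \<open>\<delta>\<close> and \<open>-\<delta>\<close>.\<close>

lemma disjoint_part_abs_weakly_null:
  fixes y z :: "nat \<Rightarrow> 'a::banach_lattice"
  assumes wn: "weakly_null (\<lambda>k. y k + z k)"
    and ces: "\<And>s. strict_mono s \<Longrightarrow> cesaro_mean (\<lambda>k. y (s k)) \<longlonglongrightarrow> w"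
    and disj: "\<And>j k. j \<noteq> k \<Longrightarrow> disjoint_elements (z j) (z k)"
  shows "weakly_null (\<lambda>k. \<bar>z k\<bar>)"
  unfolding weakly_null_def
proof (intro allI impI, rule ccontr)
  fix f :: "'a \<Rightarrow> real" assume f: "bounded_linear f" and no: "\<not> (\<lambda>k. f \<bar>z k\<bar>) \<longlonglongrightarrow> 0"
  interpret f: bounded_linear f by (rule f)
  obtain \<delta> where \<delta>: "0 < \<delta>" and inf: "\<And>N. \<exists>k\<ge>N. \<delta> \<le> \<bar>f \<bar>z k\<bar>\<bar>"
    using no unfolding LIMSEQ_iff by (auto simp: not_less)
  define A where "A = {k. \<delta> \<le> \<bar>f \<bar>z k\<bar>\<bar>}"
  have "infinite A" unfolding A_def infinite_nat_iff_unbounded_le using inf by blast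
  then have s: "strict_mono (enumerate A)" "\<And>k. enumerate A k \<in> A"
    by (auto simp: strict_mono_enumerate enumerate_in_set)
  define s where "s = enumerate A"
  have sm: "strict_mono s" and s\<delta>: "\<delta> \<le> \<bar>f \<bar>z (s k)\<bar>\<bar>" for k
    using s(1) s(2)[of k] by (simp_all add: s_def A_def)
  obtain K where K: "0 \<le> K" "\<And>x. \<bar>f x\<bar> \<le> norm x * K" using f.nonneg_bounded by auto
  \<comment> \<open>The alternating values prescribed for the functional, written as a
    graph.\<close>
  define b where "b = range (\<lambda>k. (z (s k), (-1) ^ k * \<delta>))"
  have "c \<le> K * norm v" if vc: "(v, c) \<in> span b" for v c
  proof -
    obtain t q where t: "finite t" "t \<subseteq> b" and eq: "(v, c) = (\<Sum>p\<in>t. q p *\<^sub>R p)"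
      using vc unfolding span_explicit by auto
    have v: "v = (\<Sum>p\<in>t. q p *\<^sub>R fst p)" and c: "c = (\<Sum>p\<in>t. q p * snd p)"
      using arg_cong[OF eq, of fst] arg_cong[OF eq, of snd] by (simp_all add: fst_sum snd_sum)
    \<comment> \<open>By the choice of \<open>s\<close> these ratios have modulus at most 1, so they
      turn prescribed values into values of \<open>f\<close> on moduli. Disjointness then lets the
      norm of \<open>v\<close> absorb the changed coefficients.\<close>
    define \<sigma> where "\<sigma> p = snd p / f \<bar>fst p\<bar>" for p :: "'a \<times> real"
    have \<sigma>: "\<bar>\<sigma> p\<bar> \<le> 1" "snd p = \<sigma> p * f \<bar>fst p\<bar>" if "p \<in> t" for p
    proof -
      obtain k where "p = (z (s k), (-1) ^ k * \<delta>)" using \<open>p \<in> t\<close> t(2) by (auto simp: b_def)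
      then show "\<bar>\<sigma> p\<bar> \<le> 1" "snd p = \<sigma> p * f \<bar>fst p\<bar>"
        using s\<delta>[of k] \<delta> by (auto simp: \<sigma>_def abs_mult abs_divide power_abs)
    qed
    have "c = f (\<Sum>p\<in>t. (q p * \<sigma> p) *\<^sub>R \<bar>fst p\<bar>)"
      unfolding c f.sum using \<sigma>(2) by (intro sum.cong) (auto simp: f.scaleR)
    also have "\<dots> \<le> K * norm (\<Sum>p\<in>t. (q p * \<sigma> p) *\<^sub>R \<bar>fst p\<bar>)"
      using K(2)[of "\<Sum>p\<in>t. (q p * \<sigma> p) *\<^sub>R \<bar>fst p\<bar>"] by (simp add: mult.commute)
    also have "norm (\<Sum>p\<in>t. (q p * \<sigma> p) *\<^sub>R \<bar>fst p\<bar>) \<le> norm v"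
    proof (rule norm_mono_abs)
      have "\<bar>\<Sum>p\<in>t. (q p * \<sigma> p) *\<^sub>R \<bar>fst p\<bar>\<bar> \<le> (\<Sum>p\<in>t. \<bar>(q p * \<sigma> p) *\<^sub>R \<bar>fst p\<bar>\<bar>)" by (rule abs_sum_le_lattice)
      also have "\<dots> \<le> (\<Sum>p\<in>t. \<bar>q p *\<^sub>R fst p\<bar>)"
        using \<sigma>(1) by (intro sum_mono) (auto simp: abs_scaleR_lattice abs_mult mult_left_le intro!: scaleR_right_mono)
      also have "\<dots> \<le> \<bar>\<Sum>p\<in>t. q p *\<^sub>R fst p\<bar>"
      proof (rule disjoint_sum_abs[OF t(1)])
        fix p p' assume pp: "p \<in> t" "p' \<in> t" "p \<noteq> p'"
        obtain k k' where k: "p = (z (s k), (-1) ^ k * \<delta>)" "p' = (z (s k'), (-1) ^ k' * \<delta>)"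
          using pp(1,2) t(2) unfolding b_def by (meson rangeE subsetD)
        then have "s k \<noteq> s k'" using pp(3) strict_mono_eq[OF sm] by auto
        then have "disjoint_elements (fst p) (fst p')" using disj k by simp
        then show "disjoint_elements (q p *\<^sub>R fst p) (q p' *\<^sub>R fst p')"
          by (metis disjoint_elements_commute disjoint_elements_scaleR)
      qed
      finally show "\<bar>\<Sum>p\<in>t. (q p * \<sigma> p) *\<^sub>R \<bar>fst p\<bar>\<bar> \<le> \<bar>v\<bar>" unfolding v .
    qed
    finally show ?thesis using K(1) by (simp add: mult_left_mono)
  qed
  from Hahn_Banach_graph[OF sublinear_norm[OF K(1)] subspace_span this]
  obtain g where g: "linear g" "\<And>x. g x \<le> K * norm x" "\<And>v c. (v, c) \<in> span b \<Longrightarrow> g v = c" by blast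
  have bg: "bounded_linear g" by (rule dominated_linear_bounded(2)[OF g(1,2)])
  have gz: "g (z (s k)) = (-1) ^ k * \<delta>" for k
    by (rule g(3)) (auto simp: b_def intro: span_base)
  \<comment> \<open>Where \<open>g\<close> is constantly \<open>e\<close> on \<open>z\<close>, the
    means of \<open>g\<close> on \<open>y\<close> are those of a null sequence minus
    \<open>e\<close>, while they also tend to \<open>g w\<close>.\<close>
  have gw: "g w = - e" if t: "strict_mono t" and e: "\<And>k. g (z (t k)) = e" for t :: "nat \<Rightarrow> nat" and e
  proof -
    have "(\<lambda>n. g (cesaro_mean (\<lambda>k. y (t k)) n)) \<longlonglongrightarrow> g w" by (rule bounded_linear.tendsto[OF bg ces[OF t]])
    moreover have "g (cesaro_mean (\<lambda>k. y (t k)) n) = cesaro_mean (\<lambda>k. g (y (t k) + z (t k))) n - e" for n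
      using cesaro_mean_diff[of "\<lambda>k. g (y (t k) + z (t k))" "\<lambda>_. e" n]
      by (simp add: cesaro_mean_linear[OF g(1)] linear_add[OF g(1)] e cesaro_mean_const)
    ultimately have "(\<lambda>n. cesaro_mean (\<lambda>k. g (y (t k) + z (t k))) n - e) \<longlonglongrightarrow> g w" by simp
    moreover have "(\<lambda>k. g (y (t k) + z (t k))) \<longlonglongrightarrow> 0"
      using wn bg LIMSEQ_subseq_LIMSEQ[OF _ t, of "\<lambda>k. g (y k + z k)" 0]
      by (simp add: weakly_null_def o_def)
    from tendsto_diff[OF cesaro_mean_null[OF this] tendsto_const[of e]]
    have "(\<lambda>n. cesaro_mean (\<lambda>k. g (y (t k) + z (t k))) n - e) \<longlonglongrightarrow> - e" by simp
    ultimately show ?thesis by (rule LIMSEQ_unique)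
  qed
  have "g w = - \<delta>"
    by (rule gw[of "\<lambda>k. s (2 * k)"]) (use sm in \<open>auto simp: strict_mono_def gz\<close>)
  moreover have "g w = - (- \<delta>)"
    by (rule gw[of "\<lambda>k. s (2 * k + 1)"]) (use sm in \<open>auto simp: strict_mono_def gz\<close>)
  ultimately show False using \<delta> by simp
qed

text \<open>A functional norming \<open>L\<close>, composed with \<open>T\<close>, tends to 0 along
  \<open>x\<close>, hence so do its means; thus \<open>norm L\<close> is 0.\<close>

lemma weakly_null_cesaro_limit:
  fixes T :: "'x::banach_lattice \<Rightarrow> 'y::real_normed_vector"
  assumes T: "bounded_linear T" and x: "weakly_null x" and r: "strict_mono r"
    and L: "cesaro_mean (\<lambda>n. T (x (r n))) \<longlonglongrightarrow> L"
  shows "L = 0"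
proof -
  obtain h where h: "bounded_linear h" "h L = norm L" by (rule norming_functional[of L])
  have "(\<lambda>n. h (T (x n))) \<longlonglongrightarrow> 0"
    using x[unfolded weakly_null_def, rule_format, OF bounded_linear_compose[OF h(1) T]] .
  from LIMSEQ_subseq_LIMSEQ[OF this r] have "(\<lambda>n. h (T (x (r n)))) \<longlonglongrightarrow> 0" by (simp add: o_def)
  then have "cesaro_mean (\<lambda>n. h (T (x (r n)))) \<longlonglongrightarrow> 0" by (rule cesaro_mean_null)
  moreover have "(\<lambda>n. h (cesaro_mean (\<lambda>n. T (x (r n))) n)) \<longlonglongrightarrow> h L"
    by (rule bounded_linear.tendsto[OF h(1) L])
  moreover have "(\<lambda>n. h (cesaro_mean (\<lambda>n. T (x (r n))) n)) = cesaro_mean (\<lambda>n. h (T (x (r n))))"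
    by (rule ext) (rule cesaro_mean_linear[OF bounded_linear.linear[OF h(1)]])
  ultimately have "h L = 0" by (metis LIMSEQ_unique)
  then show ?thesis using h by simp
qed

theorem proposition6p21:
  fixes S T :: "'x::banach_lattice \<Rightarrow> 'y::banach_lattice"
  assumes "order_continuous TYPE('x)"
    and "subsequence_splitting TYPE('x)"
    and "linear S" and "linear T"
    and "\<And>x. 0 \<le> x \<Longrightarrow> 0 \<le> S x \<and> S x \<le> T x"
    and "weakly_Banach_Saks T"
  shows "weakly_Banach_Saks S"
  unfolding weakly_Banach_Saks_def
proof (intro allI impI)
  fix x :: "nat \<Rightarrow> 'x" assume x: "weakly_null x"
  have S0: "\<And>x. 0 \<le> x \<Longrightarrow> 0 \<le> S x" and T0: "\<And>x. 0 \<le> x \<Longrightarrow> 0 \<le> T x" and ST: "\<And>x. 0 \<le> x \<Longrightarrow> S x \<le> T x"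
    using assms(5) order_trans by blast+
  \<comment> \<open>Positivity makes both operators continuous: \<open>S\<close> carries over the
    limit of the means of \<open>y\<close>, and \<open>T\<close> preserves weak nullity.\<close>
  have bS: "bounded_linear S" by (rule positive_linear_bounded[OF assms(3) S0])
  have bT: "bounded_linear T" by (rule positive_linear_bounded[OF assms(4) T0])
  obtain p y z where p: "strict_mono (p :: nat \<Rightarrow> nat)" and xyz: "\<And>k. x (p k) = y k + z k"
    and y: "almost_order_bounded (range y)" and z: "\<And>j k. j \<noteq> k \<Longrightarrow> disjoint_elements (z j) (z k)"
    using assms(2)[unfolded subsequence_splitting_def, rule_format, OF weakly_null_bounded[OF x]] by blast
  obtain q w where q: "strict_mono (q :: nat \<Rightarrow> nat)"
    and yw: "\<And>s. strict_mono s \<Longrightarrow> cesaro_mean (\<lambda>k. y (q (s k))) \<longlonglongrightarrow> w"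
    using almost_order_bounded_cesaro[OF assms(1) y] by blast
  have zn: "weakly_null (\<lambda>k. \<bar>z (q k)\<bar>)"
  proof (rule disjoint_part_abs_weakly_null)
    have "strict_mono (\<lambda>k. p (q k))" using p q by (simp add: strict_mono_def)
    then have "(\<lambda>k. f (x (p (q k)))) \<longlonglongrightarrow> 0" if "bounded_linear f" for f :: "'x \<Rightarrow> real"
      using x that LIMSEQ_subseq_LIMSEQ[of "\<lambda>k. f (x k)" 0 "\<lambda>k. p (q k)"]
      by (simp add: weakly_null_def o_def)
    then show "weakly_null (\<lambda>k. y (q k) + z (q k))" by (simp add: weakly_null_def xyz)
    show "cesaro_mean (\<lambda>k. y (q (s k))) \<longlonglongrightarrow> w" if "strict_mono s" for s by (rule yw[OF that])
    show "disjoint_elements (z (q j)) (z (q k))" if "j \<noteq> k" for j k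
      using z that strict_mono_eq[OF q] by blast
  qed
  \<comment> \<open>The subsequence is dictated by \<open>T\<close> on the disjoint part. The means
    of \<open>y\<close> converge along it as well, since their limit was secured for every further
    subsequence.\<close>
  then obtain s L where s: "strict_mono s" and L: "cesaro_mean (\<lambda>n. T \<bar>z (q (s n))\<bar>) \<longlonglongrightarrow> L"
    using assms(6) unfolding weakly_Banach_Saks_def convergent_def by blast
  have "L = 0" by (rule weakly_null_cesaro_limit[OF bT zn s L])
  have "cesaro_mean (\<lambda>n. S (z (q (s n)))) \<longlonglongrightarrow> 0"
  proof (rule Lim_null_comparison[OF _ tendsto_norm_zero[OF L[unfolded \<open>L = 0\<close>]]], rule always_eventually, rule allI)
    fix n
    \<comment> \<open>Domination enters here: the modulus of \<open>S v\<close> is at most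
      \<open>S\<close> of the modulus of \<open>v\<close>, hence at most \<open>T\<close> of
      it.\<close>
    have "\<bar>S v\<bar> \<le> T \<bar>v\<bar>" for v
      using positive_linear_abs[OF assms(3) S0, of v] ST[of "\<bar>v\<bar>"] by simp
    then have "cesaro_mean (\<lambda>n. \<bar>S (z (q (s n)))\<bar>) n \<le> cesaro_mean (\<lambda>n. T \<bar>z (q (s n))\<bar>) n"
      by (rule cesaro_mean_mono)
    with cesaro_mean_abs have "\<bar>cesaro_mean (\<lambda>n. S (z (q (s n)))) n\<bar> \<le> cesaro_mean (\<lambda>n. T \<bar>z (q (s n))\<bar>) n"
      by (rule order_trans)
    then show "norm (cesaro_mean (\<lambda>n. S (z (q (s n)))) n) \<le> norm (cesaro_mean (\<lambda>n. T \<bar>z (q (s n))\<bar>) n)"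
      by (intro norm_mono_abs) (rule order_trans[OF _ abs_ge_self])
  qed
  moreover have "cesaro_mean (\<lambda>n. S (y (q (s n)))) \<longlonglongrightarrow> S w"
    using bounded_linear.tendsto[OF bS yw[OF s]] by (simp add: cesaro_mean_linear[OF assms(3)])
  ultimately have "(\<lambda>n. cesaro_mean (\<lambda>n. S (y (q (s n)))) n + cesaro_mean (\<lambda>n. S (z (q (s n)))) n) \<longlonglongrightarrow> S w + 0"
    by (intro tendsto_add)
  then have "cesaro_mean (\<lambda>n. S (x (p (q (s n))))) \<longlonglongrightarrow> S w + 0"
    by (simp add: xyz linear_add[OF assms(3)] cesaro_mean_add[abs_def])
  moreover have "strict_mono (\<lambda>n. p (q (s n)))" using p q s by (simp add: strict_mono_def)
  ultimately show "\<exists>r. strict_mono r \<and> convergent (cesaro_mean (\<lambda>n. S (x (r n))))"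
    unfolding convergent_def by blast
qed

end
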